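(* For every $k,M\in\mathbb{N}$ and $\epsilon\in[0,\tfrac12)$ there exists $\ell=\ell(k,M,\epsilon)\in\mathbb{N}$ such that the following holds for every $n$ and every $A\subseteq G=\mathbb{F}_2^n$ with $\|\mathbf{1}_A\|_{A,\epsilon}\le M$: (i) if $A$ or $A^c$ is not $k$-affine connected, then $\|\mathbf{1}_A\|_A\ge \frac{\sqrt{k}}{2}$; (ii) if both $A$ and $A^c$ are $k$-affine connected, then $A$ has coset complexity at most $\ell$, and in particular $\|\mathbf{1}_A\|_A\le 3^\ell$.
   Context: $G=\mathbb{F}_2^n$. For $f:G\to\mathbb{R}$ and $a\in G$, $\widehat f(a)=\mathbb{E}_{x\in G}[f(x)(-1)^{a^tx}]$, and the algebra (spectral) norm is $\|f\|_A=\sum_{a\in G}|\widehat f(a)|$. For $\epsilon\ge 0$, the $\epsilon$-approximate algebra norm is $\|f\|_{A,\epsilon}=\inf\{\|g\|_A: g:G\to\mathbb{R},\ \|f-g\|_\infty\le\epsilon\}$. $\mathbf{1}_A$ is the indicator function of $A$ and $A^c=G\setminus A$. A coset is a coset of a subgroup (linear subspace) of $G$. A set $A\subseteq G$ has coset complexity at most $\ell$ if it belongs to the ring of sets (family of subsets of $G$ containing $G$ and closed under complements, finite unions and finite intersections) generated by at most $\ell$ cosets. A set $A\subseteq G$ is $k$-affine connected if whenever $a_0,a_0+a_1,\dots,a_0+a_k\in A$, at least one of the following holds: the vectors $a_0,a_0+a_1,\dots,a_0+a_k$ are affinely dependent; or there exists $T\subseteq\{1,\dots,k\}$ with $|T|\ge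 2$ such that $a_0+\sum_{i\in T}a_i\in A$.
   Formalization: Part (i) is proved except when k = 1 and A is empty, where it fails: for n ≥ 1 the complement of the empty set is not 1-affine connected, yet the indicator of the empty set has algebra norm 0 < 1/2. *)

theory Defs
  imports "HOL-Analysis.Analysis" "HOL-Library.Z2" "HOL-Library.Function_Algebras"
begin

text \<open>
  The dimension \<open>n\<close> is quantified inside the theorem, so it cannot be a type.  A vector of
  \<open>\<bbbF>\<^sub>2\<^sup>n\<close> is a function \<open>nat \<Rightarrow> bit\<close> vanishing from index \<open>n\<close> on;
  addition and \<open>0\<close> are the pointwise ones.
\<close>

definition cube :: "nat \<Rightarrow> (nat \<Rightarrow> bit) set" where
  "cube n = {x. \<forall>i\<ge>n. x i = 0}"

definition scale :: "bit \<Rightarrow> (nat \<Rightarrow> bit) \<Rightarrow> (nat \<Rightarrow> bit)" where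
  "scale c x = (\<lambda>i. c * x i)"

interpretation F2: vector_space scale
  by standard (auto simp: scale_def fun_eq_iff algebra_simps)

definition dot :: "nat \<Rightarrow> (nat \<Rightarrow> bit) \<Rightarrow> (nat \<Rightarrow> bit) \<Rightarrow> bit" where
  "dot n a x = (\<Sum>i<n. a i * x i)"

text \<open>The value \<open>(-1)\<^sup>b\<close> for \<open>b \<in> \<bbbF>\<^sub>2\<close>.\<close>

definition sign :: "bit \<Rightarrow> real" where
  "sign b = (if b = 0 then 1 else - 1)"

definition fourier :: "nat \<Rightarrow> ((nat \<Rightarrow> bit) \<Rightarrow> real) \<Rightarrow> (nat \<Rightarrow> bit) \<Rightarrow> real" where
  "fourier n f a = (\<Sum>x\<in>cube n. f x * sign (dot n a x)) / real (card (cube n))"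

text \<open>Functions \<open>\<bbbF>\<^sub>2\<^sup>n \<rightarrow> \<real>\<close> are total functions here; only their values on
  \<^term>\<open>cube n\<close> enter any of the definitions below.\<close>

definition algebra_norm :: "nat \<Rightarrow> ((nat \<Rightarrow> bit) \<Rightarrow> real) \<Rightarrow> real" where
  "algebra_norm n f = (\<Sum>a\<in>cube n. \<bar>fourier n f a\<bar>)"

definition sup_norm :: "nat \<Rightarrow> ((nat \<Rightarrow> bit) \<Rightarrow> real) \<Rightarrow> real" where
  "sup_norm n f = (SUP x\<in>cube n. \<bar>f x\<bar>)"

definition approx_algebra_norm :: "nat \<Rightarrow> real \<Rightarrow> ((nat \<Rightarrow> bit) \<Rightarrow> real) \<Rightarrow> real" where
  "approx_algebra_norm n \<epsilon> f = Inf {algebra_norm n g | g. sup_norm n (\<lambda>x. f x - g x) \<le> \<epsilon>}"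

definition is_coset :: "nat \<Rightarrow> (nat \<Rightarrow> bit) set \<Rightarrow> bool" where
  "is_coset n C \<longleftrightarrow>
     (\<exists>H a. H \<subseteq> cube n \<and> F2.subspace H \<and> a \<in> cube n \<and> C = (\<lambda>h. a + h) ` H)"

text \<open>The library's \<^const>\<open>algebra\<close> \<open>G R\<close> says that \<open>R\<close> is a family of subsets of \<open>G\<close> that
  contains \<open>G\<close> and is closed under complements, finite unions and finite intersections;
  \<open>algebra G hull \<C>\<close> is the least such family containing \<open>\<C>\<close>.\<close>

definition coset_complexity_le :: "nat \<Rightarrow> (nat \<Rightarrow> bit) set \<Rightarrow> nat \<Rightarrow> bool" where
  "coset_complexity_le n A l \<longleftrightarrow>
     (\<exists>\<C>. finite \<C> \<and> card \<C> \<le> l \<and> (\<forall>C\<in>\<C>. is_coset n C) \<and> A \<in> (algebra (cube n) hull \<C>))"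

text \<open>Affine dependence of the family \<open>v 0, \<dots>, v k\<close>; in particular a family with a repeated
  vector is dependent.\<close>

definition affinely_dependent :: "nat \<Rightarrow> (nat \<Rightarrow> nat \<Rightarrow> bit) \<Rightarrow> bool" where
  "affinely_dependent k v \<longleftrightarrow>
     (\<exists>c :: nat \<Rightarrow> bit. (\<exists>i\<le>k. c i \<noteq> 0) \<and> (\<Sum>i\<le>k. c i) = 0 \<and> (\<Sum>i\<le>k. scale (c i) (v i)) = 0)"

definition affine_connected :: "nat \<Rightarrow> (nat \<Rightarrow> bit) set \<Rightarrow> bool" where
  "affine_connected k A \<longleftrightarrow>
     (\<forall>a :: nat \<Rightarrow> nat \<Rightarrow> bit.
        a 0 \<in> A \<and> (\<forall>i\<in>{1..k}. a 0 + a i \<in> A) \<longrightarrow>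
        affinely_dependent k (\<lambda>i. if i = 0 then a 0 else a 0 + a i) \<or>
        (\<exists>T\<subseteq>{1..k}. card T \<ge> 2 \<and> a 0 + (\<Sum>i\<in>T. a i) \<in> A))"

text \<open>
  For \<open>k = 1\<close> a set is affine connected iff it has at most one element.  So for \<open>n \<ge> 1\<close> the
  complement of the empty set is not 1-affine connected, while the indicator of the empty set has
  norm \<open>0 < \<surd>1 / 2\<close>.  The lower bound of the theorem has to exclude this one case.
\<close>

lemma empty_set_exception:
  assumes "0 \<le> \<epsilon>"
  shows "\<not> affine_connected 1 (cube 1 - {})"
    and "algebra_norm 1 (indicat_real {}) = 0"
    and "approx_algebra_norm 1 \<epsilon> (indicat_real {}) \<le> 0"
proof -
  define e :: "nat \<Rightarrow> bit" where "e = (\<lambda>i. if i = 0 then 1 else 0)"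
  have e: "e \<in> cube 1" "0 \<in> cube 1"
    by (auto simp: e_def cube_def)
  have indep: "\<not> affinely_dependent 1 (\<lambda>i. if i = 0 then 0 else 0 + e)"
  proof
    assume "affinely_dependent 1 (\<lambda>i. if i = 0 then 0 else 0 + e)"
    then obtain c :: "nat \<Rightarrow> bit" where c: "\<exists>i\<le>1. c i \<noteq> 0" "c 0 + c 1 = 0"
      "scale (c 0) 0 + scale (c 1) e = 0"
      unfolding affinely_dependent_def by (auto simp: atMost_Suc)
    from fun_cong[OF c(3), of 0] have "c 1 = 0"
      unfolding scale_def plus_fun_def zero_fun_def e_def by simp
    with c(1,2) show False by (auto simp: le_Suc_eq)
  qed
  have small: "\<not> card T \<ge> 2" if "T \<subseteq> {1..1::nat}" for T
    using card_mono[OF _ that] by auto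
  show "\<not> affine_connected 1 (cube 1 - {})"
  proof
    let ?a = "\<lambda>i::nat. if i = 0 then 0 else e"
    assume "affine_connected 1 (cube 1 - {})"
    then have "?a 0 \<in> cube 1 - {} \<and> (\<forall>i\<in>{1..1}. ?a 0 + ?a i \<in> cube 1 - {}) \<longrightarrow>
        affinely_dependent 1 (\<lambda>i. if i = 0 then ?a 0 else ?a 0 + ?a i) \<or>
        (\<exists>T\<subseteq>{1..1}. card T \<ge> 2 \<and> ?a 0 + (\<Sum>i\<in>T. ?a i) \<in> cube 1 - {})"
      unfolding affine_connected_def by (rule spec)
    moreover have "?a 0 \<in> cube 1 - {} \<and> (\<forall>i\<in>{1..1}. ?a 0 + ?a i \<in> cube 1 - {})"
      using e by simp
    ultimately have "affinely_dependent 1 (\<lambda>i. if i = 0 then ?a 0 else ?a 0 + ?a i)"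
      using small by blast
    moreover have "(\<lambda>i. if i = 0 then ?a 0 else ?a 0 + ?a i) = (\<lambda>i. if i = 0 then 0 else 0 + e)"
      by (rule ext) simp
    ultimately have "affinely_dependent 1 (\<lambda>i. if i = 0 then 0 else 0 + e)"
      by (simp only:)
    with indep show False by blast
  qed
  show norm0: "algebra_norm 1 (indicat_real {}) = 0"
    by (simp add: algebra_norm_def fourier_def)
  let ?N = "{algebra_norm 1 g | g. sup_norm 1 (\<lambda>x. indicat_real {} x - g x) \<le> \<epsilon>}"
  have "cube 1 \<noteq> {}"
    using e(1) by blast
  then have "sup_norm 1 (\<lambda>x. indicat_real {} x - indicat_real {} x) \<le> \<epsilon>"
    using assms by (simp add: sup_norm_def)
  then have "algebra_norm 1 (indicat_real {}) \<in> ?N"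
    by blast
  moreover have "bdd_below ?N"
    by (rule bdd_belowI[of _ 0]) (auto simp only: mem_Collect_eq algebra_norm_def sum_nonneg abs_ge_zero)
  ultimately have "Inf ?N \<le> algebra_norm 1 (indicat_real {})"
    by (rule cInf_lower)
  then show "approx_algebra_norm 1 \<epsilon> (indicat_real {}) \<le> 0"
    by (simp only: approx_algebra_norm_def norm0)
qed

end

theory Submission
  imports Defs "HOL-Library.Ramsey"
begin

text \<open>
  For (i), a configuration violating affine connectedness is a restriction of \<open>\<one>\<^sub>A\<close> to an affine
  \<open>k\<close>-cube that is the indicator of \<open>k + 1\<close> points (or its complement).  Restriction does not
  increase the algebra norm, and the norm of this function is \<open>\<bbbE>\<bar>1 + r\<^sub>1 + \<dots> + r\<^sub>k\<bar>\<close> for random signs.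

  For (ii), the approximate norm only enters through stability: a function of bounded algebra norm
  that separates \<open>A\<close> from its complement writes \<open>A (x + y)\<close> as the sign of an inner product with a
  margin, so by the perceptron bound the depth of a mistake tree, hence the length of a half graph,
  is bounded.

  Suppose points \<open>a \<in> A\<close> and \<open>b \<notin> A\<close> can be chosen again and again so that no coset from a finite
  family attached to the earlier points separates them; the family consists of the sums of earlier
  points and of cosets of the translation stabilizers of the sets \<open>{y. A (x + y) for most x \<in> X}\<close>.
  By Ramsey's theorem the resulting long sequences may be taken indiscernible.  Stability and affine
  connectedness then force \<open>A (y + s)\<close> to be the same for all sums \<open>s\<close> of an odd number of terms, and
  from this sums of two terms lie in the stabilizer attached to earlier terms.  Since \<open>a\<close> and \<open>b\<close> lie
  in the same cosets of the stabilizers, \<open>a + b' + b'' \<in> A\<close> and \<open>b + b' + a'' \<notin> A\<close> for indices in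
  increasing order, and the value of \<open>b + a' + b''\<close> completes a half graph either way.  So after
  boundedly many steps the family separates \<open>A\<close> from its complement, that is, it generates \<open>A\<close>.
\<close>

section \<open>Fourier analysis on the cube\<close>

text \<open>Without the last two declarations the simplifier turns vectors into abstractions, since
  induction eta-expands terms of function type.\<close>

declare add_bit_eq_xor [simp del] and mult_bit_eq_and [simp del]
  and plus_fun_apply [simp del] and zero_fun_apply [simp del]

section \<open>Vectors, characters and their orthogonality\<close>

lemma add_self [simp]: "x + x = (0 :: nat \<Rightarrow> bit)"
  by (simp add: fun_eq_iff plus_fun_apply zero_fun_apply)

lemma add_self_left [simp]: "x + (x + y) = (y :: nat \<Rightarrow> bit)"
  by (simp flip: add.assoc)

lemma add_eq_iff: "x + y = z \<longleftrightarrow> x = z + (y :: nat \<Rightarrow> bit)"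
  by (metis add.commute add_self_left)

lemma cube_zero [simp]: "0 \<in> cube n"
  by (simp add: cube_def plus_fun_apply zero_fun_apply)

lemma cube_add [simp]: "x \<in> cube n \<Longrightarrow> y \<in> cube n \<Longrightarrow> x + y \<in> cube n"
  by (simp add: cube_def plus_fun_apply zero_fun_apply)

lemma cube_add_iff: "x \<in> cube n \<Longrightarrow> x + y \<in> cube n \<longleftrightarrow> y \<in> cube n"
  by (metis add_self_left cube_add)

lemma cube_sum:
  fixes u :: "'i \<Rightarrow> nat \<Rightarrow> bit"
  shows "(\<And>i. i \<in> I \<Longrightarrow> u i \<in> cube n) \<Longrightarrow> (\<Sum>i\<in>I. u i) \<in> cube n"
  by (induction I rule: infinite_finite_induct) auto

lemma finite_cube [simp]: "finite (cube n)"
proof (rule finite_imageD)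
  show "finite ((\<lambda>x. {i. x i \<noteq> 0}) ` cube n)"
    by (rule finite_subset[of _ "Pow {..<n}"]) (auto simp: cube_def not_less intro: leI)
  show "inj_on (\<lambda>x. {i. x i \<noteq> 0}) (cube n)"
    by (intro inj_onI ext) (auto simp: set_eq_iff, metis bit_not_one_iff)
qed

lemma card_cube_pos [simp]: "card (cube n) > 0"
  using cube_zero by (metis card_gt_0_iff empty_iff finite_cube)

lemma sign_0 [simp]: "sign 0 = 1"
  by (simp add: sign_def)

lemma sign_add: "sign (a + b) = sign a * sign b"
  by (cases a; cases b) (simp_all add: sign_def)

lemma abs_sign [simp]: "\<bar>sign b\<bar> = 1"
  by (simp add: sign_def)

lemma sign_mult_self [simp]: "sign b * sign b = 1"
  by (simp add: sign_def)

lemma dot_0_right [simp]: "dot n a 0 = 0"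
  by (simp add: dot_def zero_fun_apply)

lemma dot_0_left [simp]: "dot n 0 a = 0"
  by (simp add: dot_def zero_fun_apply)

lemma dot_commute: "dot n a x = dot n x a"
  unfolding dot_def by (simp only: mult.commute)

lemma dot_add_right: "dot n a (x + y) = dot n a x + dot n a y"
  unfolding dot_def plus_fun_def by (simp only: distrib_left sum.distrib)

lemma dot_add_left: "dot n (a + b) x = dot n a x + dot n b x"
  by (simp only: dot_commute[of n _ x] dot_add_right)

lemma sign_dot_sum:
  fixes u :: "'i \<Rightarrow> nat \<Rightarrow> bit" and a :: "nat \<Rightarrow> bit"
  shows "sign (dot n a (\<Sum>i\<in>I. u i)) = (\<Prod>i\<in>I. sign (dot n a (u i)))"
  by (induction I rule: infinite_finite_induct) (simp_all add: dot_add_right sign_add)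

lemma sum_translate:
  fixes e :: "nat \<Rightarrow> bit"
  assumes "\<And>x y. x \<in> H \<Longrightarrow> y \<in> H \<Longrightarrow> x + y \<in> H" and "e \<in> H"
  shows "(\<Sum>h\<in>H. f (e + h)) = (\<Sum>h\<in>H. f h)"
  by (rule sum.reindex_bij_witness[of _ "\<lambda>h. e + h" "\<lambda>h. e + h"]) (use assms in auto)

text \<open>If some \<open>e\<close> in \<open>H\<close> has sign \<open>- 1\<close> on
  \<open>x\<close>, translating the sum by \<open>e\<close> negates it, so it vanishes.\<close>

lemma sum_sign_subspace:
  fixes x :: "nat \<Rightarrow> bit"
  assumes "\<And>x y. x \<in> H \<Longrightarrow> y \<in> H \<Longrightarrow> x + y \<in> H"
  shows "(\<Sum>h\<in>H. sign (dot n h x)) = (if \<forall>h\<in>H. dot n h x = 0 then real (card H) else 0)"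
proof (cases "\<forall>h\<in>H. dot n h x = 0")
  case False
  then obtain e where e: "e \<in> H" "sign (dot n e x) = - 1"
    by (auto simp: sign_def)
  have "(\<Sum>h\<in>H. sign (dot n h x)) = (\<Sum>h\<in>H. sign (dot n (e + h) x))"
    by (intro sum_translate[symmetric] assms e(1))
  also have "\<dots> = - (\<Sum>h\<in>H. sign (dot n h x))"
    by (simp only: dot_add_left sign_add e(2) mult_minus1 sum_negf)
  finally show ?thesis
    by (simp add: if_not_P[OF False])
qed simp

lemma ex_dot_nonzero:
  assumes "x \<in> cube n" "x \<noteq> 0"
  shows "\<exists>e\<in>cube n. dot n e x \<noteq> 0"
proof -
  obtain i where i: "x i \<noteq> 0" using assms(2) by (auto simp: fun_eq_iff zero_fun_apply)
  then have "i < n" using assms(1) by (auto simp: cube_def intro: leI)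
  define e :: "nat \<Rightarrow> bit" where "e = (\<lambda>j. if j = i then 1 else 0)"
  have "dot n e x = (\<Sum>j<n. if j = i then x j else 0)"
    unfolding dot_def e_def by (rule sum.cong) auto
  also have "\<dots> = x i"
    using \<open>i < n\<close> by (subst sum.delta) auto
  finally show ?thesis
    using i \<open>i < n\<close> by (intro bexI[of _ e]) (auto simp: e_def cube_def)
qed

lemma sum_sign_cube:
  assumes "x \<in> cube n"
  shows "(\<Sum>a\<in>cube n. sign (dot n a x)) = (if x = 0 then real (card (cube n)) else 0)"
proof -
  have "(\<forall>a\<in>cube n. dot n a x = 0) \<longleftrightarrow> x = 0"
    using ex_dot_nonzero[OF assms] by (metis dot_0_right)
  then show ?thesis
    using sum_sign_subspace[of "cube n" n x] by simp
qed

lemma fourier_inversion: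
  assumes "x \<in> cube n"
  shows "f x = (\<Sum>a\<in>cube n. fourier n f a * sign (dot n a x))"
proof -
  have "(\<Sum>a\<in>cube n. fourier n f a * sign (dot n a x))
      = (\<Sum>a\<in>cube n. \<Sum>y\<in>cube n. f y * sign (dot n a (x + y)) / real (card (cube n)))"
    unfolding fourier_def dot_add_right sign_add
    by (simp add: sum_divide_distrib sum_distrib_left sum_distrib_right mult_ac)
  also have "\<dots> = (\<Sum>y\<in>cube n. f y * (\<Sum>a\<in>cube n. sign (dot n a (x + y))) / real (card (cube n)))"
    by (subst sum.swap) (simp add: sum_divide_distrib sum_distrib_left)
  also have "\<dots> = (\<Sum>y\<in>cube n. if y = x then f y else 0)"
  proof (rule sum.cong[OF refl])
    fix y assume y: "y \<in> cube n"
    have "x + y = 0 \<longleftrightarrow> y = x"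
      by (metis add_self_left add_self add.right_neutral)
    then show "f y * (\<Sum>a\<in>cube n. sign (dot n a (x + y))) / real (card (cube n)) = (if y = x then f y else 0)"
      using assms y sum_sign_cube[of "x + y" n] by auto
  qed
  also have "\<dots> = f x"
    using assms by (simp add: sum.delta')
  finally show ?thesis ..
qed

section \<open>The algebra norm\<close>

lemma fourier_add: "fourier n (\<lambda>x. f x + g x) a = fourier n f a + fourier n g a"
  by (simp add: fourier_def distrib_right sum.distrib add_divide_distrib)

lemma fourier_scale: "fourier n (\<lambda>x. c * f x) a = c * fourier n f a"
  by (simp add: fourier_def sum_distrib_left mult.assoc sum_divide_distrib)

lemma fourier_cong: "(\<And>x. x \<in> cube n \<Longrightarrow> f x = g x) \<Longrightarrow> fourier n f a = fourier n g a"
  unfolding fourier_def by (simp cong: sum.cong)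

lemma algebra_norm_cong: "(\<And>x. x \<in> cube n \<Longrightarrow> f x = g x) \<Longrightarrow> algebra_norm n f = algebra_norm n g"
  unfolding algebra_norm_def using fourier_cong[of n f g] by simp

lemma algebra_norm_nonneg: "algebra_norm n f \<ge> 0"
  by (simp add: algebra_norm_def sum_nonneg)

lemma algebra_norm_add: "algebra_norm n (\<lambda>x. f x + g x) \<le> algebra_norm n f + algebra_norm n g"
  unfolding algebra_norm_def fourier_add sum.distrib[symmetric] by (intro sum_mono abs_triangle_ineq)

lemma algebra_norm_scale: "algebra_norm n (\<lambda>x. c * f x) = \<bar>c\<bar> * algebra_norm n f"
  by (simp add: algebra_norm_def fourier_scale abs_mult sum_distrib_left)

lemma algebra_norm_sum: "algebra_norm n (\<lambda>x. \<Sum>i\<in>I. f i x) \<le> (\<Sum>i\<in>I. algebra_norm n (f i))"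
proof (induction I rule: infinite_finite_induct)
  case (insert i I)
  then show ?case
    using algebra_norm_add[of n "f i" "\<lambda>x. \<Sum>i\<in>I. f i x"] by simp
qed (simp_all add: algebra_norm_def fourier_def)

lemma algebra_norm_character:
  assumes "b \<in> cube n"
  shows "algebra_norm n (\<lambda>x. sign (dot n b x)) = 1"
proof -
  have "fourier n (\<lambda>x. sign (dot n b x)) a = (if a = b then 1 else 0)" if "a \<in> cube n" for a
  proof -
    have "fourier n (\<lambda>x. sign (dot n b x)) a = (\<Sum>x\<in>cube n. sign (dot n x (a + b))) / real (card (cube n))"
      unfolding fourier_def sign_add[symmetric] dot_commute[of n _ "a + b"]
      by (simp only: dot_add_left add.commute)
    moreover have "a + b = 0 \<longleftrightarrow> a = b"
      by (simp only: add_eq_iff add_0)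
    ultimately show ?thesis
      using assms that by (auto simp: sum_sign_cube)
  qed
  then show ?thesis
    using assms by (simp add: algebra_norm_def if_distrib[of abs] sum.delta cong: sum.cong if_cong)
qed

text \<open>The product of two characters is a character and has norm one. Expanding both factors
  therefore bounds the norm by the sum of all products of absolute coefficients.\<close>

lemma algebra_norm_mult:
  "algebra_norm n (\<lambda>x. f x * g x) \<le> algebra_norm n f * algebra_norm n g"
proof -
  have "algebra_norm n (\<lambda>x. f x * g x)
      = algebra_norm n (\<lambda>x. \<Sum>a\<in>cube n. \<Sum>b\<in>cube n. fourier n f a * fourier n g b * sign (dot n (a + b) x))"
  proof (rule algebra_norm_cong)
    fix x assume "x \<in> cube n"
    then have "f x * g x = (\<Sum>a\<in>cube n. fourier n f a * sign (dot n a x))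
        * (\<Sum>b\<in>cube n. fourier n g b * sign (dot n b x))"
      by (simp flip: fourier_inversion)
    then show "f x * g x
        = (\<Sum>a\<in>cube n. \<Sum>b\<in>cube n. fourier n f a * fourier n g b * sign (dot n (a + b) x))"
      by (simp add: sum_product dot_add_left sign_add mult_ac)
  qed
  also have "\<dots> \<le> (\<Sum>a\<in>cube n. algebra_norm n (\<lambda>x. \<Sum>b\<in>cube n. fourier n f a * fourier n g b * sign (dot n (a + b) x)))"
    by (rule algebra_norm_sum)
  also have "\<dots> \<le> (\<Sum>a\<in>cube n. \<Sum>b\<in>cube n. algebra_norm n (\<lambda>x. fourier n f a * fourier n g b * sign (dot n (a + b) x)))"
    by (intro sum_mono algebra_norm_sum)
  also have "\<dots> = (\<Sum>a\<in>cube n. \<Sum>b\<in>cube n. \<bar>fourier n f a\<bar> * \<bar>fourier n g b\<bar>)"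
    by (intro sum.cong refl) (simp add: algebra_norm_scale algebra_norm_character abs_mult)
  finally show ?thesis
    by (simp add: algebra_norm_def sum_product)
qed

lemma abs_le_algebra_norm:
  assumes "x \<in> cube n"
  shows "\<bar>f x\<bar> \<le> algebra_norm n f"
proof -
  have "\<bar>f x\<bar> = \<bar>\<Sum>a\<in>cube n. fourier n f a * sign (dot n a x)\<bar>"
    using fourier_inversion[OF assms] by simp
  also have "\<dots> \<le> (\<Sum>a\<in>cube n. \<bar>fourier n f a * sign (dot n a x)\<bar>)"
    by (rule sum_abs)
  finally show ?thesis
    by (simp add: algebra_norm_def abs_mult)
qed

lemma algebra_norm_const: "algebra_norm n (\<lambda>x. c) = \<bar>c\<bar>"
  using algebra_norm_scale[of n c "\<lambda>x. sign (dot n 0 x)"] algebra_norm_character[of 0 n] by simp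

text \<open>The coefficients of a subspace indicator are nonnegative, so by inversion they add up to
  its value at 0, which is 1. Translation only multiplies them by signs.\<close>

lemma algebra_norm_coset:
  assumes "is_coset n C"
  shows "algebra_norm n (indicat_real C) \<le> 1"
proof -
  obtain H a where H: "H \<subseteq> cube n" "F2.subspace H" "a \<in> cube n" and C: "C = (\<lambda>h. a + h) ` H"
    using assms by (auto simp: is_coset_def)
  have add: "x + y \<in> H" if "x \<in> H" "y \<in> H" for x y
    using H(2) that F2.subspace_add by blast
  have zero: "0 \<in> H"
    using H(2) F2.subspace_0 by blast
  have fH: "finite H"
    using H(1) finite_cube finite_subset by blast
  have eq: "fourier n (indicat_real D) b = (\<Sum>x\<in>D. sign (dot n b x)) / real (card (cube n))"
    if "D \<subseteq> cube n" for D b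
  proof -
    have "(\<Sum>x\<in>cube n. indicat_real D x * sign (dot n b x)) = (\<Sum>x\<in>D. sign (dot n b x))"
      using that by (intro sum.mono_neutral_cong_right) (auto simp: indicator_def)
    then show ?thesis
      by (simp add: fourier_def)
  qed
  have nonneg: "fourier n (indicat_real H) b \<ge> 0" for b
    using H(1) add by (simp add: eq dot_commute[of n b] sum_sign_subspace)
  have "\<bar>fourier n (indicat_real C) b\<bar> = fourier n (indicat_real H) b" if "b \<in> cube n" for b
  proof -
    have "C \<subseteq> cube n"
      using H C by auto
    then have "fourier n (indicat_real C) b = (\<Sum>h\<in>H. sign (dot n b (a + h))) / real (card (cube n))"
      by (subst eq) (auto simp: C sum.reindex)
    also have "\<dots> = sign (dot n b a) * fourier n (indicat_real H) b"
      using H(1) by (simp only: eq dot_add_right sign_add sum_distrib_left[symmetric]) simp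
    finally show ?thesis
      using nonneg by (simp add: abs_mult)
  qed
  then have "algebra_norm n (indicat_real C) = (\<Sum>b\<in>cube n. fourier n (indicat_real H) b * sign (dot n b 0))"
    by (simp add: algebra_norm_def)
  also have "\<dots> = 1"
    using zero fourier_inversion[of 0 n "indicat_real H"] by simp
  finally show ?thesis by simp
qed

section \<open>Rings of sets generated by cosets\<close>

text \<open>Induction on the family: split the indicator along one coset \<open>C\<close> and its
  complement. The factor 3 is the bound 1 for the norm of the indicator of \<open>C\<close> plus the
  bound 2 for that of one minus it.\<close>

lemma algebra_norm_atoms:
  assumes "finite \<C>" and "\<And>C. C \<in> \<C> \<Longrightarrow> is_coset n C"
    and "\<And>x y. x \<in> cube n \<Longrightarrow> y \<in> cube n \<Longrightarrow> (\<And>C. C \<in> \<C> \<Longrightarrow> x \<in> C \<longleftrightarrow> y \<in> C) \<Longrightarrow> x \<in> A \<longleftrightarrow> y \<in> A"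
  shows "algebra_norm n (indicat_real A) \<le> 3 ^ card \<C>"
  using assms
proof (induction \<C> arbitrary: A rule: finite_induct)
  case empty
  have "algebra_norm n (indicat_real A) = algebra_norm n (\<lambda>x. indicat_real A 0)"
  proof (rule algebra_norm_cong)
    fix x assume "x \<in> cube n"
    then have "x \<in> A \<longleftrightarrow> 0 \<in> A"
      by (intro empty(2)) auto
    then show "indicat_real A x = indicat_real A 0"
      by (simp add: indicator_def)
  qed
  also have "\<dots> \<le> 3 ^ card {}"
    by (simp add: algebra_norm_const)
  finally show ?case .
next
  case (insert C \<C>)
  \<comment> \<open>The part of \<open>A\<close> inside \<open>D\<close>, saturated under the
    remaining cosets. It falls under the induction hypothesis, and on \<open>D\<close> it agrees
    with \<open>A\<close>.\<close>
  define S where "S D = {x \<in> cube n. \<exists>y\<in>cube n. y \<in> A \<and> y \<in> D \<and> (\<forall>E\<in>\<C>. x \<in> E \<longleftrightarrow> y \<in> E)}" for D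
  have S: "algebra_norm n (indicat_real (S D)) \<le> 3 ^ card \<C>" for D
  proof (rule insert.IH)
    show "is_coset n E" if "E \<in> \<C>" for E
      using insert.prems(1) that by blast
    fix x y assume "x \<in> cube n" "y \<in> cube n" "\<And>E. E \<in> \<C> \<Longrightarrow> x \<in> E \<longleftrightarrow> y \<in> E"
    then show "x \<in> S D \<longleftrightarrow> y \<in> S D"
      unfolding S_def by auto
  qed
  have mem: "x \<in> A \<longleftrightarrow> x \<in> S D" if "x \<in> cube n" "x \<in> D" "D = C \<or> D = - C" for x D
  proof
    show "x \<in> S D" if "x \<in> A"
      using that \<open>x \<in> cube n\<close> \<open>x \<in> D\<close> unfolding S_def by blast
    assume "x \<in> S D"
    then obtain y where y: "y \<in> cube n" "y \<in> A" "y \<in> D" "\<And>E. E \<in> \<C> \<Longrightarrow> x \<in> E \<longleftrightarrow> y \<in> E"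
      unfolding S_def by blast
    then have "x \<in> A \<longleftrightarrow> y \<in> A"
      using that by (intro insert.prems(2)) auto
    with y show "x \<in> A" by blast
  qed
  let ?c = "indicat_real C" and ?f = "indicat_real (S C)" and ?g = "indicat_real (S (- C))"
  have c: "algebra_norm n ?c \<le> 1"
    using insert.prems(1) algebra_norm_coset by blast
  have "algebra_norm n (indicat_real A) = algebra_norm n (\<lambda>x. ?c x * ?f x + (1 + (- 1) * ?c x) * ?g x)"
  proof (rule algebra_norm_cong)
    fix x assume "x \<in> cube n"
    then show "indicat_real A x = ?c x * ?f x + (1 + (- 1) * ?c x) * ?g x"
      using mem[of x C] mem[of x "- C"] by (auto simp: indicator_def)
  qed
  also have "\<dots> \<le> algebra_norm n (\<lambda>x. ?c x * ?f x) + algebra_norm n (\<lambda>x. (1 + (- 1) * ?c x) * ?g x)"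
    by (rule algebra_norm_add)
  also have "\<dots> \<le> algebra_norm n ?c * algebra_norm n ?f
      + algebra_norm n (\<lambda>x. 1 + (- 1) * ?c x) * algebra_norm n ?g"
    by (intro add_mono algebra_norm_mult)
  also have "\<dots> \<le> 1 * 3 ^ card \<C> + 2 * 3 ^ card \<C>"
  proof (intro add_mono mult_mono S c)
    have "algebra_norm n (\<lambda>x. 1 + (- 1) * ?c x) \<le> algebra_norm n (\<lambda>x. 1) + algebra_norm n (\<lambda>x. (- 1) * ?c x)"
      by (rule algebra_norm_add)
    also have "\<dots> \<le> 2"
      using c by (simp only: algebra_norm_scale algebra_norm_const)
    finally show "algebra_norm n (\<lambda>x. 1 + (- 1) * ?c x) \<le> 2" .
  qed (auto intro: algebra_norm_nonneg)
  finally show ?case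
    using insert.hyps by simp
qed

text \<open>The subsets that do not distinguish \<open>x\<close> from \<open>y\<close> form an
  algebra containing the generators, hence containing the hull.\<close>

lemma hull_algebra_atoms:
  assumes "A \<in> algebra \<Omega> hull \<C>" and "\<C> \<subseteq> Pow \<Omega>" and "x \<in> \<Omega>" "y \<in> \<Omega>"
    and "\<And>C. C \<in> \<C> \<Longrightarrow> x \<in> C \<longleftrightarrow> y \<in> C"
  shows "x \<in> A \<longleftrightarrow> y \<in> A"
proof -
  have "algebra \<Omega> {A. A \<subseteq> \<Omega> \<and> (x \<in> A \<longleftrightarrow> y \<in> A)}"
    using assms(3,4) by (auto simp: algebra_iff_Un)
  then have "algebra \<Omega> hull \<C> \<subseteq> {A. A \<subseteq> \<Omega> \<and> (x \<in> A \<longleftrightarrow> y \<in> A)}"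
    using assms(2,5) by (intro hull_minimal) auto
  then show ?thesis
    using assms(1) by blast
qed

lemma coset_subset_cube: "is_coset n C \<Longrightarrow> C \<subseteq> cube n"
  by (auto simp: is_coset_def)

lemma algebra_norm_coset_complexity:
  assumes "coset_complexity_le n A l"
  shows "algebra_norm n (indicat_real A) \<le> 3 ^ l"
proof -
  obtain \<C> where \<C>: "finite \<C>" "card \<C> \<le> l" "\<forall>C\<in>\<C>. is_coset n C" "A \<in> algebra (cube n) hull \<C>"
    using assms by (auto simp: coset_complexity_le_def)
  have "algebra_norm n (indicat_real A) \<le> 3 ^ card \<C>"
  proof (rule algebra_norm_atoms)
    show "x \<in> A \<longleftrightarrow> y \<in> A" if "x \<in> cube n" "y \<in> cube n" "\<And>C. C \<in> \<C> \<Longrightarrow> x \<in> C \<longleftrightarrow> y \<in> C" for x y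
      using \<C>(3) coset_subset_cube by (intro hull_algebra_atoms[OF \<C>(4) _ that]) auto
  qed (use \<C> in auto)
  also have "\<dots> \<le> 3 ^ l"
    using \<C>(2) by (simp add: power_increasing)
  finally show ?thesis .
qed

text \<open>Since the family separates \<open>A\<close> from its complement, \<open>A\<close> is the
  union of the atoms of its points. Atoms are indexed by subfamilies of \<open>\<C>\<close>, so this
  union is finite.\<close>

lemma mem_hull_algebra:
  assumes "finite \<C>" and "\<C> \<subseteq> Pow \<Omega>" and "A \<subseteq> \<Omega>"
    and "\<And>x y. x \<in> A \<Longrightarrow> y \<in> \<Omega> - A \<Longrightarrow> \<exists>C\<in>\<C>. x \<in> C \<longleftrightarrow> y \<notin> C"
  shows "A \<in> algebra \<Omega> hull \<C>"
proof -
  have "A \<in> \<A>" if alg: "algebra \<Omega> \<A>" and sub: "\<C> \<subseteq> \<A>" for \<A>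
  proof -
    interpret algebra \<Omega> \<A> by fact
    define atom where "atom x = (\<Inter>C\<in>\<C>. if x \<in> C then C else \<Omega> - C) \<inter> \<Omega>" for x
    have atom: "atom x \<in> \<A>" for x
    proof -
      have "(\<Inter>C\<in>\<D>. if x \<in> C then C else \<Omega> - C) \<inter> \<Omega> \<in> \<A>" if "finite \<D>" "\<D> \<subseteq> \<C>" for \<D>
        using that
      proof (induction \<D>)
        case (insert C \<D>)
        have "(if x \<in> C then C else \<Omega> - C) \<in> \<A>"
          using insert.prems sub by auto
        then have "(if x \<in> C then C else \<Omega> - C) \<inter> ((\<Inter>C\<in>\<D>. if x \<in> C then C else \<Omega> - C) \<inter> \<Omega>) \<in> \<A>"
          using insert.prems by (intro Int insert.IH) auto
        then show ?case
          by (simp only: INT_insert Int_assoc)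
      qed auto
      then show ?thesis
        using assms(1) by (auto simp: atom_def)
    qed
    have "atom ` A \<subseteq> (\<lambda>\<D>. (\<Inter>C\<in>\<C>. if C \<in> \<D> then C else \<Omega> - C) \<inter> \<Omega>) ` Pow \<C>"
    proof
      fix B assume "B \<in> atom ` A"
      then obtain x where "B = atom x" by blast
      then have "B = (\<Inter>C\<in>\<C>. if C \<in> {C \<in> \<C>. x \<in> C} then C else \<Omega> - C) \<inter> \<Omega>"
        by (simp add: atom_def)
      then show "B \<in> (\<lambda>\<D>. (\<Inter>C\<in>\<C>. if C \<in> \<D> then C else \<Omega> - C) \<inter> \<Omega>) ` Pow \<C>"
        by (rule image_eqI) auto
    qed
    then have "finite (atom ` A)"
      using assms(1) by (meson finite_Pow_iff finite_imageI finite_subset)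
    then have "\<Union>(atom ` A) \<in> \<A>"
      using atom by (intro finite_Union) auto
    moreover have "\<Union>(atom ` A) = A"
    proof
      show "A \<subseteq> \<Union>(atom ` A)"
        using assms(3) by (auto simp: atom_def split: if_splits)
      show "\<Union>(atom ` A) \<subseteq> A"
      proof
        fix y assume "y \<in> \<Union>(atom ` A)"
        then obtain x where x: "x \<in> A" "y \<in> atom x" by blast
        show "y \<in> A"
        proof (rule ccontr)
          assume "y \<notin> A"
          then obtain C where "C \<in> \<C>" "x \<in> C \<longleftrightarrow> y \<notin> C"
            using x assms(4)[of x y] by (auto simp: atom_def)
          with x show False
            by (auto simp: atom_def split: if_splits)
        qed
      qed
    qed
    ultimately show ?thesis by simp
  qed
  then show ?thesis
    by (auto simp: hull_def)
qed

section \<open>The norm of a set that is not affine connected\<close>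

lemma sum_signs_moments:
  fixes x :: real
  shows "(\<Sum>R\<in>Pow {..<k}. (x + (\<Sum>i<k. if i \<in> R then - 1 else 1)) ^ 2) = 2 ^ k * (x ^ 2 + real k)"
    and "(\<Sum>R\<in>Pow {..<k}. (x + (\<Sum>i<k. if i \<in> R then - 1 else 1)) ^ 4)
      = 2 ^ k * (x ^ 4 + 6 * x ^ 2 * real k + 3 * real k ^ 2 - 2 * real k)"
proof -
  \<comment> \<open>The sign of the last index shifts \<open>x\<close> up or down by one. Both
    moments then follow by induction on \<open>k\<close> for all \<open>x\<close> at once.\<close>
  have step: "(\<Sum>R\<in>Pow {..<Suc k}. f (x + (\<Sum>i<Suc k. if i \<in> R then - 1 else 1)))
      = (\<Sum>R\<in>Pow {..<k}. f ((x + 1) + (\<Sum>i<k. if i \<in> R then - 1 else 1)))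
      + (\<Sum>R\<in>Pow {..<k}. f ((x - 1) + (\<Sum>i<k. if i \<in> R then - 1 else 1)))"
    for f :: "real \<Rightarrow> real" and x :: real and k :: nat
  proof -
    have inj: "inj_on (insert k) (Pow {..<k})"
      by (intro inj_onI) (metis PowD insert_ident lessThan_iff less_irrefl subsetD)
    have eq: "(\<Sum>i<k. if i \<in> insert k R then - 1 else 1) = (\<Sum>i<k. if i \<in> R then - 1 else (1::real))" for R
      by (intro sum.cong) auto
    have "(\<Sum>R\<in>Pow {..<Suc k}. f (x + (\<Sum>i<Suc k. if i \<in> R then - 1 else 1)))
      = (\<Sum>R\<in>Pow {..<k}. f (x + (\<Sum>i<Suc k. if i \<in> R then - 1 else 1)))
      + (\<Sum>R\<in>insert k ` Pow {..<k}. f (x + (\<Sum>i<Suc k. if i \<in> R then - 1 else 1)))"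
      unfolding lessThan_Suc Pow_insert by (intro sum.union_disjoint) auto
    also have "(\<Sum>R\<in>insert k ` Pow {..<k}. f (x + (\<Sum>i<Suc k. if i \<in> R then - 1 else 1)))
      = (\<Sum>R\<in>Pow {..<k}. f ((x - 1) + (\<Sum>i<k. if i \<in> R then - 1 else 1)))"
      by (simp only: sum.reindex[OF inj] comp_def sum.lessThan_Suc eq insertI1 if_True)
        (simp add: algebra_simps)
    also have "(\<Sum>R\<in>Pow {..<k}. f (x + (\<Sum>i<Suc k. if i \<in> R then - 1 else 1)))
      = (\<Sum>R\<in>Pow {..<k}. f ((x + 1) + (\<Sum>i<k. if i \<in> R then - 1 else 1)))"
    proof (rule sum.cong[OF refl])
      fix R assume "R \<in> Pow {..<k}"
      then have "k \<notin> R" by auto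
      then show "f (x + (\<Sum>i<Suc k. if i \<in> R then - 1 else 1))
        = f ((x + 1) + (\<Sum>i<k. if i \<in> R then - 1 else 1))"
        by (simp add: algebra_simps)
    qed
    finally show ?thesis .
  qed
  show "(\<Sum>R\<in>Pow {..<k}. (x + (\<Sum>i<k. if i \<in> R then - 1 else 1)) ^ 2) = 2 ^ k * (x ^ 2 + real k)"
    by (induction k arbitrary: x) (simp, simp only: step[of "\<lambda>s. s ^ 2"], simp add: algebra_simps power2_eq_square)
  show "(\<Sum>R\<in>Pow {..<k}. (x + (\<Sum>i<k. if i \<in> R then - 1 else 1)) ^ 4)
      = 2 ^ k * (x ^ 4 + 6 * x ^ 2 * real k + 3 * real k ^ 2 - 2 * real k)"
    by (induction k arbitrary: x)
      (simp, simp only: step[of "\<lambda>s. s ^ 4"], simp add: algebra_simps power2_eq_square power4_eq_xxxx)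
qed

text \<open>With \<open>t = \<bar>s\<bar> / q\<close> this is
  \<open>t * (t - 1) ^ 2 * (t + 2) \<ge> 0\<close>. It bounds a first absolute moment from below by
  the second and fourth moments.\<close>

lemma abs_ge_moments:
  fixes s q :: real
  assumes "q > 0"
  shows "\<bar>s\<bar> \<ge> 3 / (2 * q) * s ^ 2 - 1 / (2 * q ^ 3) * s ^ 4"
proof -
  define t where "t = \<bar>s\<bar> / q"
  have t: "t \<ge> 0" "\<bar>s\<bar> = q * t"
    using assms by (auto simp: t_def)
  have "t * (t - 1) ^ 2 * (t + 2) \<ge> 0"
    using t by simp
  then have "3 * t ^ 2 - t ^ 4 \<le> 2 * t"
    by (simp add: algebra_simps power2_eq_square power4_eq_xxxx)
  then have "q / 2 * (3 * t ^ 2 - t ^ 4) \<le> q / 2 * (2 * t)"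
    using assms by (intro mult_left_mono) auto
  moreover have "s ^ 2 = q ^ 2 * t ^ 2"
    using t(2) by (metis power2_abs power_mult_distrib)
  moreover from this have "s ^ 4 = q ^ 4 * t ^ 4"
    using power_mult[of s 2 2] power_mult[of q 2 2] power_mult[of t 2 2] by (simp add: power_mult_distrib)
  moreover have "3 / (2 * q) * (q ^ 2 * t ^ 2) - 1 / (2 * q ^ 3) * (q ^ 4 * t ^ 4) = q / 2 * (3 * t ^ 2 - t ^ 4)"
    using assms by (simp add: field_simps power2_eq_square power3_eq_cube power4_eq_xxxx)
  ultimately show ?thesis
    using t(2) by simp
qed

lemma khintchine_l1:
  "(\<Sum>R\<in>Pow {..<k}. \<bar>1 + (\<Sum>i<k. if i \<in> R then - 1 else 1)\<bar>) \<ge> 2 ^ k * (sqrt (real k) / 2)"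
proof -
  \<comment> \<open>The best scale for \<open>abs_ge_moments\<close>: \<open>q ^ 2\<close> is the
    fourth moment \<open>(3 * k + 1) * (k + 1)\<close> divided by the second moment
    \<open>k + 1\<close>. The resulting bound is \<open>(k + 1) / q\<close>.\<close>
  define q where "q = sqrt (3 * real k + 1)"
  define S :: "nat set \<Rightarrow> real" where "S R = 1 + (\<Sum>i<k. if i \<in> R then - 1 else 1)" for R
  have q: "q > 0" "q ^ 2 = 3 * real k + 1"
    by (auto simp: q_def)
  have "sqrt (real k) / 2 = sqrt (real k / 4)"
    by (simp add: real_sqrt_divide)
  also have "\<dots> \<le> sqrt ((real k + 1) ^ 2 / (3 * real k + 1))"
    by (intro real_sqrt_le_mono) (simp add: field_simps power2_eq_square)
  also have "\<dots> = (real k + 1) / q"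
    by (simp add: q_def real_sqrt_divide)
  finally have "2 ^ k * (sqrt (real k) / 2) \<le> 2 ^ k * ((real k + 1) / q)"
    by (rule mult_left_mono) simp
  also have "\<dots> = 3 / (2 * q) * (2 ^ k * (1 + real k))
      - 1 / (2 * q ^ 3) * (2 ^ k * ((3 * real k + 1) * (real k + 1)))"
  proof -
    have "P * (K / q) = 3 / (2 * q) * (P * K) - 1 / (2 * q ^ 3) * (P * (q ^ 2 * K))" for P K
      using q(1) by (simp add: field_simps power2_eq_square power3_eq_cube)
    from this[of "2 ^ k" "real k + 1"] show ?thesis
      by (simp only: q(2) add.commute)
  qed
  also have "\<dots> = (\<Sum>R\<in>Pow {..<k}. 3 / (2 * q) * S R ^ 2 - 1 / (2 * q ^ 3) * S R ^ 4)"
    unfolding sum_subtractf sum_distrib_left[symmetric] S_def sum_signs_moments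
    by (simp add: algebra_simps power2_eq_square)
  also have "\<dots> \<le> (\<Sum>R\<in>Pow {..<k}. \<bar>S R\<bar>)"
    using q(1) by (intro sum_mono abs_ge_moments)
  finally show ?thesis
    by (simp add: S_def)
qed

section \<open>Restriction to affine cubes\<close>

text \<open>The left side is \<open>2 ^ k\<close> times the algebra norm of the pullback of
  \<open>f\<close> to a \<open>k\<close>-dimensional cube indexed by the sets \<open>T\<close>.
  Characters pull back to characters up to sign, so the norm does not grow.\<close>

lemma algebra_norm_restrict:
  assumes a: "\<And>i. i \<le> k \<Longrightarrow> a i \<in> cube n"
  shows "(\<Sum>R\<in>Pow {1..k}. \<bar>\<Sum>T\<in>Pow {1..k}. f (a 0 + (\<Sum>i\<in>T. a i)) * (- 1) ^ card (R \<inter> T)\<bar>)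
    \<le> 2 ^ k * algebra_norm n f"
proof -
  \<comment> \<open>The unnormalised coefficient at \<open>R\<close> of the character pulled back
    from \<open>c\<close>. Each factor is 0 or 2, so it is nonnegative, and the sum over all
    \<open>R\<close> is the product of \<open>k\<close> twos.\<close>
  define w where "w c R = (\<Prod>i\<in>{1..k}. sign (dot n c (a i)) * (if i \<in> R then - 1 else 1) + 1)" for c R
  have coef: "(\<Sum>T\<in>Pow {1..k}. f (a 0 + (\<Sum>i\<in>T. a i)) * (- 1) ^ card (R \<inter> T))
      = (\<Sum>c\<in>cube n. fourier n f c * sign (dot n c (a 0)) * w c R)" if R: "R \<subseteq> {1..k}" for R
  proof -
    have "(\<Sum>T\<in>Pow {1..k}. f (a 0 + (\<Sum>i\<in>T. a i)) * (- 1) ^ card (R \<inter> T))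
      = (\<Sum>T\<in>Pow {1..k}. \<Sum>c\<in>cube n. fourier n f c * sign (dot n c (a 0))
          * (\<Prod>i\<in>T. sign (dot n c (a i)) * (if i \<in> R then - 1 else 1)))"
    proof (rule sum.cong[OF refl])
      fix T assume T: "T \<in> Pow {1..k}"
      have mem: "a 0 + (\<Sum>i\<in>T. a i) \<in> cube n"
        using T by (intro cube_add cube_sum a) auto
      have fin: "finite T"
        using T finite_subset by auto
      have "(\<Prod>i\<in>T. if i \<in> R then - 1 else (1::real)) = (- 1) ^ card (R \<inter> T)"
        using fin by (simp add: prod.If_cases Int_commute)
      then show "f (a 0 + (\<Sum>i\<in>T. a i)) * (- 1) ^ card (R \<inter> T) = (\<Sum>c\<in>cube n. fourier n f c
          * sign (dot n c (a 0)) * (\<Prod>i\<in>T. sign (dot n c (a i)) * (if i \<in> R then - 1 else 1)))"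
        by (subst fourier_inversion[OF mem])
          (simp add: dot_add_right sign_add sign_dot_sum prod.distrib sum_distrib_left sum_distrib_right mult_ac)
    qed
    also have "\<dots> = (\<Sum>c\<in>cube n. fourier n f c * sign (dot n c (a 0)) * w c R)"
      unfolding w_def by (subst sum.swap) (simp add: prod_add sum_distrib_left)
    finally show ?thesis .
  qed
  have w_nonneg: "w c R \<ge> 0" for c R
    unfolding w_def by (intro prod_nonneg) (simp add: sign_def)
  have w_sum: "(\<Sum>R\<in>Pow {1..k}. w c R) = 2 ^ k" for c
  proof -
    have w_eq: "w c R = (\<Prod>i\<in>R. 1 - sign (dot n c (a i))) * (\<Prod>i\<in>{1..k} - R. 1 + sign (dot n c (a i)))"
      if "R \<subseteq> {1..k}" for R
    proof -
      have "w c R = (\<Prod>i\<in>{1..k}. if i \<in> R then 1 - sign (dot n c (a i)) else 1 + sign (dot n c (a i)))"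
        unfolding w_def by (intro prod.cong) auto
      also have "\<dots> = (\<Prod>i\<in>R. 1 - sign (dot n c (a i))) * (\<Prod>i\<in>{1..k} - R. 1 + sign (dot n c (a i)))"
      proof -
        have "{1..k} \<inter> {i. i \<in> R} = R" "{1..k} \<inter> - {i. i \<in> R} = {1..k} - R"
          using that by auto
        then show ?thesis by (simp add: prod.If_cases)
      qed
      finally show ?thesis .
    qed
    have "(\<Sum>R\<in>Pow {1..k}. w c R)
      = (\<Prod>i\<in>{1..k}. (1 - sign (dot n c (a i))) + (1 + sign (dot n c (a i))))"
      by (subst prod_add) (auto simp: w_eq intro: sum.cong)
    then show ?thesis by simp
  qed
  have "(\<Sum>R\<in>Pow {1..k}. \<bar>\<Sum>T\<in>Pow {1..k}. f (a 0 + (\<Sum>i\<in>T. a i)) * (- 1) ^ card (R \<inter> T)\<bar>)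
    \<le> (\<Sum>R\<in>Pow {1..k}. \<Sum>c\<in>cube n. \<bar>fourier n f c\<bar> * w c R)"
  proof (rule sum_mono)
    fix R assume R: "R \<in> Pow {1..k}"
    have "\<bar>\<Sum>c\<in>cube n. fourier n f c * sign (dot n c (a 0)) * w c R\<bar>
      \<le> (\<Sum>c\<in>cube n. \<bar>fourier n f c * sign (dot n c (a 0)) * w c R\<bar>)"
      by (rule sum_abs)
    also have "\<dots> = (\<Sum>c\<in>cube n. \<bar>fourier n f c\<bar> * w c R)"
      using w_nonneg by (simp add: abs_mult)
    finally show "\<bar>\<Sum>T\<in>Pow {1..k}. f (a 0 + (\<Sum>i\<in>T. a i)) * (- 1) ^ card (R \<inter> T)\<bar>
      \<le> (\<Sum>c\<in>cube n. \<bar>fourier n f c\<bar> * w c R)"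
      using R coef[of R] by (simp only: Pow_iff)
  qed
  also have "\<dots> = (\<Sum>c\<in>cube n. \<bar>fourier n f c\<bar> * (\<Sum>R\<in>Pow {1..k}. w c R))"
    by (subst sum.swap) (simp only: sum_distrib_left)
  also have "\<dots> = 2 ^ k * algebra_norm n f"
    by (simp only: w_sum algebra_norm_def sum_distrib_left mult.commute)
  finally show ?thesis .
qed

text \<open>The coefficient of the simplex at \<open>R\<close> is one plus \<open>k\<close> signs,
  so \<open>khintchine_l1\<close> applies. Up to sign, passing to \<open>1 - f\<close> changes only
  the coefficient at the empty set, from \<open>k + 1\<close> to \<open>2 ^ k - (k + 1)\<close>,
  which is not smaller once \<open>k \<ge> 3\<close>.\<close>

lemma algebra_norm_simplex:
  assumes a: "\<And>i. i \<le> k \<Longrightarrow> a i \<in> cube n"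
    and f: "\<And>T. T \<subseteq> {1..k} \<Longrightarrow> f (a 0 + (\<Sum>i\<in>T. a i)) = (if card T \<le> 1 then 1 else 0)"
  shows "sqrt (real k) / 2 \<le> algebra_norm n f"
    and "k \<ge> 3 \<Longrightarrow> sqrt (real k) / 2 \<le> algebra_norm n (\<lambda>x. 1 - f x)"
proof -
  define S :: "nat set \<Rightarrow> real" where "S R = 1 + (\<Sum>i\<in>{1..k}. if i \<in> R then - 1 else 1)" for R
  define F where "F R = (\<Sum>T\<in>Pow {1..k}. f (a 0 + (\<Sum>i\<in>T. a i)) * (- 1) ^ card (R \<inter> T))" for R
  have F: "F R = S R" if "R \<subseteq> {1..k}" for R
  proof -
    have small: "{T \<in> Pow {1..k}. card T \<le> 1} = insert {} ((\<lambda>i. {i}) ` {1..k})"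
    proof (intro equalityI subsetI)
      fix T assume T: "T \<in> {T \<in> Pow {1..k}. card T \<le> 1}"
      then have "finite T" using finite_subset by auto
      then have "T = {} \<or> (\<exists>i. T = {i})"
        using T by (auto simp: le_Suc_eq card_1_singleton_iff)
      then show "T \<in> insert {} ((\<lambda>i. {i}) ` {1..k})"
        using T by auto
    qed auto
    have "F R = (\<Sum>T\<in>{T \<in> Pow {1..k}. card T \<le> 1}. (- 1) ^ card (R \<inter> T))"
      unfolding F_def by (intro sum.mono_neutral_cong_right) (auto simp: f)
    also have "\<dots> = 1 + (\<Sum>T\<in>(\<lambda>i. {i}) ` {1..k}. (- 1 :: real) ^ card (R \<inter> T))"
      unfolding small by (subst sum.insert) auto
    also have "(\<Sum>T\<in>(\<lambda>i. {i}) ` {1..k}. (- 1 :: real) ^ card (R \<inter> T)) = (\<Sum>i\<in>{1..k}. (- 1 :: real) ^ card (R \<inter> {i}))"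
      by (subst sum.reindex) auto
    also have "\<dots> = (\<Sum>i\<in>{1..k}. if i \<in> R then - 1 else (1 :: real))"
      by (intro sum.cong) auto
    finally show ?thesis
      by (simp add: S_def)
  qed
  have SS: "(\<Sum>R\<in>Pow {1..k}. \<bar>S R\<bar>) \<ge> 2 ^ k * (sqrt (real k) / 2)"
  proof -
    have "(\<Sum>R\<in>Pow {..<k}. \<bar>1 + (\<Sum>i<k. if i \<in> R then - 1 else 1)\<bar>) = (\<Sum>R\<in>Pow {1..k}. \<bar>S R\<bar>)"
    proof (rule sum.reindex_bij_witness[of _ "\<lambda>R. (\<lambda>i. i - 1) ` R" "\<lambda>R. Suc ` R"])
      fix R :: "nat set" assume "R \<in> Pow {..<k}"
      show "\<bar>S (Suc ` R)\<bar> = \<bar>1 + (\<Sum>i<k. if i \<in> R then - 1 else 1)\<bar>"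
      proof -
        have "(\<Sum>i\<in>{1..k}. if i \<in> Suc ` R then - 1 else (1::real)) = (\<Sum>i<k. if i \<in> R then - 1 else 1)"
          by (rule sum.reindex_bij_witness[of _ Suc "\<lambda>i. i - 1"]) (auto intro: rev_image_eqI)
        then show ?thesis by (simp add: S_def)
      qed
    next
      fix R assume R: "R \<in> Pow {1..k}"
      show "Suc ` (\<lambda>i. i - 1) ` R = R"
      proof -
        have "Suc ` (\<lambda>i. i - 1) ` R = (\<lambda>i. i) ` R"
          unfolding image_image using R by (intro image_cong) auto
        then show ?thesis by simp
      qed
      show "(\<lambda>i. i - 1) ` R \<in> Pow {..<k}"
        using R by fastforce
    qed (auto simp: image_image)
    with khintchine_l1[of k] show ?thesis by simp
  qed
  also have "(\<Sum>R\<in>Pow {1..k}. \<bar>S R\<bar>) \<le> 2 ^ k * algebra_norm n f"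
    using algebra_norm_restrict[where k = k and a = a and n = n, OF a, where f = f] F by (simp add: F_def)
  finally show "sqrt (real k) / 2 \<le> algebra_norm n f" by simp
  assume k: "k \<ge> 3"
  define G where "G R = (\<Sum>T\<in>Pow {1..k}. (1 - f (a 0 + (\<Sum>i\<in>T. a i))) * (- 1) ^ card (R \<inter> T))" for R
  have G: "G R = (if R = {} then 2 ^ k else 0) - S R" if R: "R \<subseteq> {1..k}" for R
  proof -
    have "(\<Sum>T\<in>Pow {1..k}. (- 1) ^ card (R \<inter> T)) = (if R = {} then 2 ^ k else (0::real))"
    proof -
      have "(\<Sum>T\<in>Pow {1..k}. (- 1 :: real) ^ card (R \<inter> T))
        = (\<Sum>T\<in>Pow {1..k}. (\<Prod>i\<in>T. if i \<in> R then - 1 else 1) * (\<Prod>i\<in>{1..k} - T. 1))"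
      proof (rule sum.cong[OF refl])
        fix T assume "T \<in> Pow {1..k}"
        then have "finite T" using finite_subset by auto
        then show "(- 1 :: real) ^ card (R \<inter> T) = (\<Prod>i\<in>T. if i \<in> R then - 1 else 1) * (\<Prod>i\<in>{1..k} - T. 1)"
          by (simp add: prod.If_cases Int_commute)
      qed
      also have "\<dots> = (\<Prod>i\<in>{1..k}. (if i \<in> R then - 1 else 1) + 1)"
        by (simp add: prod_add)
      also have "\<dots> = (if R = {} then 2 ^ k else 0)"
      proof (cases "R = {}")
        case False
        then obtain j where "j \<in> R" "j \<in> {1..k}" using R by blast
        then show ?thesis by (auto intro!: prod_zero)
      qed simp
      finally show ?thesis .
    qed
    then show ?thesis
      using F[OF R] by (simp add: G_def F_def left_diff_distrib sum_subtractf)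
  qed
  have "(\<Sum>R\<in>Pow {1..k}. \<bar>S R\<bar>) \<le> (\<Sum>R\<in>Pow {1..k}. \<bar>G R\<bar>)"
  proof (rule sum_mono)
    fix R assume R: "R \<in> Pow {1..k}"
    show "\<bar>S R\<bar> \<le> \<bar>G R\<bar>"
    proof (cases "R = {}")
      case True
      have "2 * (k + 1) \<le> 2 ^ k"
        using k by (induction k rule: dec_induct) auto
      then have "2 * (real k + 1) \<le> 2 ^ k"
        by (metis (mono_tags) of_nat_le_iff of_nat_mult of_nat_add of_nat_1 of_nat_numeral of_nat_power)
      moreover have "S {} = real k + 1"
        by (simp add: S_def)
      ultimately show ?thesis
        using True G[of "{}"] by simp
    qed (use R G in auto)
  qed
  with SS have "2 ^ k * (sqrt (real k) / 2) \<le> (\<Sum>R\<in>Pow {1..k}. \<bar>G R\<bar>)"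
    by linarith
  also have "\<dots> \<le> 2 ^ k * algebra_norm n (\<lambda>x. 1 - f x)"
    using algebra_norm_restrict[where k = k and a = a and n = n, OF a, where f = "\<lambda>x. 1 - f x"] by (simp add: G_def)
  finally show "sqrt (real k) / 2 \<le> algebra_norm n (\<lambda>x. 1 - f x)" by simp
qed

lemma not_affine_connected_simplex:
  assumes "\<not> affine_connected k B" and "B \<subseteq> cube n"
  obtains a where "\<And>i. i \<le> k \<Longrightarrow> a i \<in> cube n"
    and "\<And>T. T \<subseteq> {1..k} \<Longrightarrow> a 0 + (\<Sum>i\<in>T. a i) \<in> B \<longleftrightarrow> card T \<le> 1"
proof -
  obtain a where a: "a 0 \<in> B" "\<forall>i\<in>{1..k}. a 0 + a i \<in> B"
    "\<And>T. T \<subseteq> {1..k} \<Longrightarrow> card T \<ge> 2 \<Longrightarrow> a 0 + (\<Sum>i\<in>T. a i) \<notin> B"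
    using assms(1) unfolding affine_connected_def by blast
  show ?thesis
  proof (rule that)
    show "a i \<in> cube n" if "i \<le> k" for i
    proof (cases "i = 0")
      case False
      then have "a 0 + a i \<in> cube n" "a 0 \<in> cube n"
        using that a(1,2) assms(2) by auto
      then show ?thesis
        by (simp add: cube_add_iff)
    qed (use a(1) assms(2) in auto)
    fix T assume T: "T \<subseteq> {1..k}"
    have "finite T" using T finite_subset by auto
    show "a 0 + (\<Sum>i\<in>T. a i) \<in> B \<longleftrightarrow> card T \<le> 1"
    proof
      show "a 0 + (\<Sum>i\<in>T. a i) \<in> B" if "card T \<le> 1"
      proof -
        have "T = {} \<or> (\<exists>i. T = {i})"
          using that \<open>finite T\<close> by (auto simp: le_Suc_eq card_1_singleton_iff)
        then show ?thesis using a(1,2) T by auto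
      qed
    qed (use a(3)[OF T] in linarith)
  qed
qed

lemma algebra_norm_ge_not_connected:
  assumes A: "A \<subseteq> cube n" and nc: "\<not> affine_connected k A \<or> \<not> affine_connected k (cube n - A)"
    and exc: "\<not> (k = 1 \<and> A = {})"
  shows "algebra_norm n (indicat_real A) \<ge> sqrt (real k) / 2"
  using nc
proof
  assume "\<not> affine_connected k A"
  then obtain a where "\<And>i. i \<le> k \<Longrightarrow> a i \<in> cube n"
    and "\<And>T. T \<subseteq> {1..k} \<Longrightarrow> a 0 + (\<Sum>i\<in>T. a i) \<in> A \<longleftrightarrow> card T \<le> 1"
    using A by (rule not_affine_connected_simplex) blast
  then show ?thesis
    by (intro algebra_norm_simplex(1)[of k a]) (auto simp: indicator_def)
next
  assume "\<not> affine_connected k (cube n - A)"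
  then obtain a where a: "\<And>i. i \<le> k \<Longrightarrow> a i \<in> cube n"
    and T: "\<And>T. T \<subseteq> {1..k} \<Longrightarrow> a 0 + (\<Sum>i\<in>T. a i) \<in> cube n - A \<longleftrightarrow> card T \<le> 1"
    using not_affine_connected_simplex[of k "cube n - A" n] by blast
  have norm_eq: "algebra_norm n (indicat_real A) = algebra_norm n (\<lambda>x. 1 - indicat_real (cube n - A) x)"
    by (intro algebra_norm_cong) (auto simp: indicator_def)
  \<comment> \<open>For \<open>k \<le> 2\<close> the bound is at most one, so a single point of
    \<open>A\<close> suffices. For \<open>k = 2\<close> it is the fourth vertex of the square; for
    \<open>k = 1\<close> it exists because the empty set is excluded.\<close>
  consider "k = 0" | "k = 1" | "k = 2" | "k \<ge> 3" by linarith
  then show ?thesis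
  proof cases
    case 4
    then show ?thesis
      unfolding norm_eq using a T by (intro algebra_norm_simplex(2)[of k a]) (auto simp: indicator_def)
  next
    case 1
    then show ?thesis by (simp add: algebra_norm_nonneg)
  next
    case 2
    then obtain x where "x \<in> A" "x \<in> cube n" using exc A by blast
    then show ?thesis
      using abs_le_algebra_norm[of x n "indicat_real A"] 2 by simp
  next
    case 3
    have "a 0 + (\<Sum>i\<in>{1..2}. a i) \<in> cube n"
      using a 3 by (intro cube_add cube_sum) auto
    then have "a 0 + (\<Sum>i\<in>{1..2}. a i) \<in> A" "a 0 + (\<Sum>i\<in>{1..2}. a i) \<in> cube n"
      using T[of "{1..2}"] 3 by auto
    then have "1 \<le> algebra_norm n (indicat_real A)"
      using abs_le_algebra_norm[of "a 0 + (\<Sum>i\<in>{1..2}. a i)" n "indicat_real A"] by simp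
    moreover have "sqrt 2 / 2 \<le> (1::real)"
      using real_sqrt_le_mono[of 2 4] by simp
    ultimately show ?thesis using 3 by simp
  qed
qed

section \<open>Stability\<close>

text \<open>Complete mistake trees of depth \<open>d\<close>: inner nodes carry a query
  \<open>y\<close>, and every branch is followed by some element of \<open>Z\<close>. The largest
  depth over the whole cube is the Littlestone dimension of the relation
  \<open>z + y \<in> B\<close>.\<close>

fun shatter :: "nat \<Rightarrow> (nat \<Rightarrow> bit) set \<Rightarrow> nat \<Rightarrow> (nat \<Rightarrow> bit) set \<Rightarrow> bool" where
  "shatter n B 0 Z \<longleftrightarrow> Z \<noteq> {}"
| "shatter n B (Suc d) Z \<longleftrightarrow>
     (\<exists>y\<in>cube n. shatter n B d {z \<in> Z. z + y \<in> B} \<and> shatter n B d {z \<in> Z. z + y \<notin> B})"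

lemma shatter_mono: "shatter n B d Z \<Longrightarrow> Z \<subseteq> Z' \<Longrightarrow> shatter n B d Z'"
proof (induction d arbitrary: Z Z')
  case (Suc d)
  obtain y where y: "y \<in> cube n" "shatter n B d {z \<in> Z. z + y \<in> B}" "shatter n B d {z \<in> Z. z + y \<notin> B}"
    using Suc.prems(1) by auto
  have "shatter n B d {z \<in> Z'. z + y \<in> B}"
    using Suc.prems(2) by (intro Suc.IH[OF y(2)]) auto
  moreover have "shatter n B d {z \<in> Z'. z + y \<notin> B}"
    using Suc.prems(2) by (intro Suc.IH[OF y(3)]) auto
  ultimately show ?case using y(1) by auto
qed auto

text \<open>Binary search: the middle query \<open>y (2 ^ d)\<close> separates the first half of the
  \<open>x i\<close> from the second, and each half is again a half graph with its own half of the
  queries.\<close>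

lemma halfgraph_shatter:
  fixes x y :: "nat \<Rightarrow> nat \<Rightarrow> bit"
  assumes "\<And>j. j < 2 ^ d \<Longrightarrow> y j \<in> cube n"
    and "\<And>i j. i < 2 ^ d \<Longrightarrow> j < 2 ^ d \<Longrightarrow> x i + y j \<in> B \<longleftrightarrow> (i < j) = c"
  shows "shatter n B d (x ` {..<2 ^ d})"
  using assms
proof (induction d arbitrary: x y)
  case (Suc d)
  let ?Z = "x ` {..<2 ^ Suc d}" and ?y = "y (2 ^ d)"
  have 1: "shatter n B d (x ` {..<2 ^ d})"
    using Suc.prems by (intro Suc.IH[of y]) auto
  have 2: "shatter n B d ((\<lambda>i. x (2 ^ d + i)) ` {..<2 ^ d})"
    using Suc.prems by (intro Suc.IH[of "\<lambda>j. y (2 ^ d + j)"]) auto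
  have mem1: "x i \<in> ?Z \<and> (x i + ?y \<in> B \<longleftrightarrow> c)" if "i < 2 ^ d" for i
    using that Suc.prems(2)[of i "2 ^ d"] by auto
  have mem2: "x (2 ^ d + i) \<in> ?Z \<and> (x (2 ^ d + i) + ?y \<in> B \<longleftrightarrow> \<not> c)" if "i < 2 ^ d" for i
    using that Suc.prems(2)[of "2 ^ d + i" "2 ^ d"] by auto
  have sub: "x ` {..<2 ^ d} \<subseteq> {z \<in> ?Z. (z + ?y \<in> B) = c}"
    "(\<lambda>i. x (2 ^ d + i)) ` {..<2 ^ d} \<subseteq> {z \<in> ?Z. (z + ?y \<in> B) = (\<not> c)}"
    unfolding image_subset_iff Ball_def lessThan_iff mem_Collect_eq using mem1 mem2 by blast+
  have "shatter n B d {z \<in> ?Z. z + ?y \<in> B} \<and> shatter n B d {z \<in> ?Z. z + ?y \<notin> B}"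
    using shatter_mono[OF 1 sub(1)] shatter_mono[OF 2 sub(2)] by (cases c) simp_all
  moreover have "?y \<in> cube n"
    using Suc.prems(1) by simp
  ultimately show ?case
    unfolding shatter.simps by blast
qed auto

text \<open>The mistake bound of the perceptron: along the branch on which the current weight vector
  \<open>w\<close> errs at every node, the margin of \<open>w\<close> grows linearly and its energy at most linearly.\<close>

lemma shatter_perceptron:
  fixes n :: nat and f :: "(nat \<Rightarrow> bit) \<Rightarrow> real"
  defines "pot \<equiv> (\<lambda>w z. \<Sum>a\<in>cube n. fourier n f a * sign (dot n a z) * w a)"
    and "energy \<equiv> (\<lambda>w. \<Sum>a\<in>cube n. \<bar>fourier n f a\<bar> * w a ^ 2)"
  assumes "shatter n B d Z" and "Z \<subseteq> cube n" and "\<And>z. z \<in> Z \<Longrightarrow> pot w z \<ge> c"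
    and f: "\<And>x. x \<in> B \<Longrightarrow> f x \<ge> \<delta>" "\<And>x. x \<in> cube n \<Longrightarrow> x \<notin> B \<Longrightarrow> f x \<le> - \<delta>"
  shows "\<exists>z\<in>Z. \<exists>w'. pot w' z \<ge> c + real d * \<delta> \<and> energy w' \<le> energy w + real d * algebra_norm n f"
  using assms(3-5)
proof (induction d arbitrary: Z w c)
  case 0
  then show ?case by auto
next
  case (Suc d)
  obtain y where y: "y \<in> cube n" "shatter n B d {z \<in> Z. z + y \<in> B}" "shatter n B d {z \<in> Z. z + y \<notin> B}"
    using Suc.prems(1) by auto
  \<comment> \<open>In the inner product with weights \<open>\<bar>fourier n f a\<bar>\<close>,
    \<open>t\<close> is the prediction of \<open>w\<close> for the query \<open>y\<close>. The
    answer \<open>s\<close> contradicts it, so the cross term \<open>2 * (s * t)\<close> in the new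
    energy is at most 0.\<close>
  define t where "t = (\<Sum>a\<in>cube n. \<bar>fourier n f a\<bar> * (w a * sign (dot n a y)))"
  define s :: real where "s = (if t \<le> 0 then 1 else - 1)"
  define w1 where "w1 a = w a + s * sign (dot n a y)" for a
  have s2: "s * s = 1" and st: "s * t \<le> 0"
    by (auto simp: s_def)
  have "energy w1 = (\<Sum>a\<in>cube n. \<bar>fourier n f a\<bar> * w a ^ 2
      + 2 * s * (\<bar>fourier n f a\<bar> * (w a * sign (dot n a y))) + \<bar>fourier n f a\<bar>)"
    unfolding energy_def
  proof (rule sum.cong[OF refl])
    fix a
    have "w1 a ^ 2 = w a ^ 2 + 2 * s * (w a * sign (dot n a y)) + (s * s) * (sign (dot n a y) * sign (dot n a y))"
      by (simp add: w1_def power2_eq_square algebra_simps)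
    then show "\<bar>fourier n f a\<bar> * w1 a ^ 2 = \<bar>fourier n f a\<bar> * w a ^ 2
      + 2 * s * (\<bar>fourier n f a\<bar> * (w a * sign (dot n a y))) + \<bar>fourier n f a\<bar>"
      by (simp add: s2 algebra_simps)
  qed
  also have "\<dots> = energy w + 2 * (s * t) + algebra_norm n f"
    by (simp add: sum.distrib energy_def algebra_norm_def t_def sum_distrib_left mult.assoc)
  finally have energy: "energy w1 \<le> energy w + algebra_norm n f"
    using st by simp
  have pot: "pot w1 z = pot w z + s * f (z + y)" if "z \<in> cube n" for z
  proof -
    have "pot w1 z = pot w z + s * (\<Sum>a\<in>cube n. fourier n f a * sign (dot n a (z + y)))"
      by (simp add: pot_def w1_def dot_add_right sign_add distrib_left sum.distrib sum_distrib_left mult_ac)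
    then show ?thesis
      using fourier_inversion[of "z + y" n f] that y(1) by simp
  qed
  \<comment> \<open>The child whose elements give the answer \<open>s\<close>. There
    \<open>s * f (z + y)\<close> is at least the margin, which is the gain in potential.\<close>
  define Z1 where "Z1 = (if t \<le> 0 then {z \<in> Z. z + y \<in> B} else {z \<in> Z. z + y \<notin> B})"
  have Z1: "Z1 \<subseteq> Z" "shatter n B d Z1"
    using y by (auto simp: Z1_def)
  have "pot w1 z \<ge> c + \<delta>" if z: "z \<in> Z1" for z
  proof -
    have zc: "z \<in> cube n" "z \<in> Z"
      using z Z1(1) Suc.prems(2) by auto
    have "s * f (z + y) \<ge> \<delta>"
      using z f(1)[of "z + y"] f(2)[of "z + y"] zc(1) y(1) by (auto simp: Z1_def s_def split: if_splits)
    then show ?thesis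
      using pot[OF zc(1)] Suc.prems(3)[OF zc(2)] by linarith
  qed
  then obtain z w' where "z \<in> Z1" "pot w' z \<ge> (c + \<delta>) + real d * \<delta>"
    "energy w' \<le> energy w1 + real d * algebra_norm n f"
    using Suc.IH[OF Z1(2), where w = w1 and c = "c + \<delta>"] Z1(1) Suc.prems(2) by blast
  moreover have "energy w1 + real d * algebra_norm n f \<le> energy w + real (Suc d) * algebra_norm n f"
    using energy by (simp add: distrib_right)
  moreover have "(c + \<delta>) + real d * \<delta> = c + real (Suc d) * \<delta>"
    by (simp add: distrib_right)
  ultimately show ?case
    using Z1(1) by (metis order_trans subsetD)
qed

text \<open>Starting from weight zero, some leaf has potential at least \<open>d * \<delta>\<close>.
  By Cauchy-Schwarz its square is at most the norm times the energy, and the energy is at most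
  \<open>d\<close> times the norm.\<close>

lemma shatter_bound:
  fixes f :: "(nat \<Rightarrow> bit) \<Rightarrow> real"
  assumes "shatter n B d (cube n)" and "0 \<le> \<delta>"
    and f: "\<And>x. x \<in> B \<Longrightarrow> f x \<ge> \<delta>" "\<And>x. x \<in> cube n \<Longrightarrow> x \<notin> B \<Longrightarrow> f x \<le> - \<delta>"
  shows "real d * \<delta> ^ 2 \<le> algebra_norm n f ^ 2"
proof (cases "d = 0")
  case False
  obtain z w where z: "(\<Sum>a\<in>cube n. fourier n f a * sign (dot n a z) * w a) \<ge> 0 + real d * \<delta>"
    and w: "(\<Sum>a\<in>cube n. \<bar>fourier n f a\<bar> * w a ^ 2)
      \<le> (\<Sum>a\<in>cube n. \<bar>fourier n f a\<bar> * 0 ^ 2) + real d * algebra_norm n f"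
    using shatter_perceptron[OF assms(1) order_refl, where w = "\<lambda>_. 0" and c = 0 and f = f and \<delta> = \<delta>] f by auto
  have "real d * \<delta> \<le> (\<Sum>a\<in>cube n. sqrt \<bar>fourier n f a\<bar> * (sqrt \<bar>fourier n f a\<bar> * \<bar>w a\<bar>))"
  proof -
    have "real d * \<delta> \<le> (\<Sum>a\<in>cube n. \<bar>fourier n f a * sign (dot n a z) * w a\<bar>)"
      by (rule order_trans[OF _ sum_mono[OF abs_ge_self]]) (use z in simp)
    also have "\<dots> = (\<Sum>a\<in>cube n. sqrt \<bar>fourier n f a\<bar> * (sqrt \<bar>fourier n f a\<bar> * \<bar>w a\<bar>))"
      by (intro sum.cong) (auto simp: abs_mult simp flip: mult.assoc)
    finally show ?thesis .
  qed
  then have "(real d * \<delta>) ^ 2 \<le> (\<Sum>a\<in>cube n. sqrt \<bar>fourier n f a\<bar> * (sqrt \<bar>fourier n f a\<bar> * \<bar>w a\<bar>)) ^ 2"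
    using assms(2) by (intro power_mono) auto
  also have "\<dots> \<le> (\<Sum>a\<in>cube n. sqrt \<bar>fourier n f a\<bar> ^ 2) * (\<Sum>a\<in>cube n. (sqrt \<bar>fourier n f a\<bar> * \<bar>w a\<bar>) ^ 2)"
    by (rule Cauchy_Schwarz_ineq_sum)
  also have "\<dots> = algebra_norm n f * (\<Sum>a\<in>cube n. \<bar>fourier n f a\<bar> * w a ^ 2)"
    by (simp add: algebra_norm_def power_mult_distrib)
  also have "\<dots> \<le> algebra_norm n f * (real d * algebra_norm n f)"
    using w by (intro mult_left_mono algebra_norm_nonneg) simp
  finally have "real d * (real d * \<delta> ^ 2) \<le> real d * algebra_norm n f ^ 2"
    by (simp add: power2_eq_square algebra_simps)
  with False show ?thesis by simp
qed simp

text \<open>An approximant of the indicator, lowered by \<open>1 / 2\<close>, separates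
  \<open>A\<close> from its complement with margin \<open>1 / 2 - \<epsilon>\<close>, so
  \<open>shatter_bound\<close> limits the depth.\<close>

lemma approx_norm_not_shatter:
  assumes \<epsilon>: "0 \<le> \<epsilon>" "\<epsilon> < 1 / 2" and A: "A \<subseteq> cube n"
    and norm: "approx_algebra_norm n \<epsilon> (indicat_real A) \<le> real M"
    and d: "real d > ((real M + 2) / (1 / 2 - \<epsilon>)) ^ 2"
  shows "\<not> shatter n A d (cube n)"
proof
  assume sh: "shatter n A d (cube n)"
  define S where "S = {algebra_norm n g | g. sup_norm n (\<lambda>x. indicat_real A x - g x) \<le> \<epsilon>}"
  have "sup_norm n (\<lambda>x. indicat_real A x - indicat_real A x) \<le> \<epsilon>"
    using \<epsilon>(1) cube_zero[of n] by (subst sup_norm_def, simp, subst cSUP_const) blast+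
  then have "S \<noteq> {}"
    unfolding S_def by blast
  \<comment> \<open>The slack of one avoids asking whether the infimum is attained. Together with
    the shift by \<open>1 / 2\<close> it fits into the bound \<open>M + 2\<close> for the norm of
    \<open>f\<close>.\<close>
  moreover have "Inf S < real M + 1"
    using norm by (simp add: approx_algebra_norm_def S_def)
  ultimately obtain v where "v \<in> S" "v < real M + 1"
    using cInf_lessD by blast
  then obtain g where g: "algebra_norm n g < real M + 1" "sup_norm n (\<lambda>x. indicat_real A x - g x) \<le> \<epsilon>"
    by (auto simp: S_def)
  have close: "\<bar>indicat_real A x - g x\<bar> \<le> \<epsilon>" if "x \<in> cube n" for x
  proof -
    have "\<bar>indicat_real A x - g x\<bar> \<le> sup_norm n (\<lambda>x. indicat_real A x - g x)"
      unfolding sup_norm_def using that by (intro cSUP_upper bdd_above_finite) auto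
    with g(2) show ?thesis by linarith
  qed
  define f where "f x = g x + - (1 / 2)" for x
  have "algebra_norm n f \<le> algebra_norm n g + algebra_norm n (\<lambda>x. - (1 / 2))"
    unfolding f_def by (rule algebra_norm_add)
  also have "algebra_norm n (\<lambda>x. - (1 / 2)) = 1 / 2"
    by (simp add: algebra_norm_const)
  finally have "algebra_norm n f \<le> real M + 2"
    using g(1) by linarith
  then have "algebra_norm n f ^ 2 \<le> (real M + 2) ^ 2"
    by (intro power_mono algebra_norm_nonneg)
  moreover have "real d * (1 / 2 - \<epsilon>) ^ 2 \<le> algebra_norm n f ^ 2"
  proof (rule shatter_bound[OF sh])
    show "1 / 2 - \<epsilon> \<le> f x" if "x \<in> A" for x
    proof -
      have "\<bar>1 - g x\<bar> \<le> \<epsilon>"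
        using close[of x] that A by (simp add: subset_iff)
      then show ?thesis
        by (simp add: f_def abs_le_iff)
    qed
    show "f x \<le> - (1 / 2 - \<epsilon>)" if "x \<in> cube n" "x \<notin> A" for x
      using close[of x] that unfolding f_def by simp
  qed (use \<epsilon> in simp)
  ultimately have "real d * (1 / 2 - \<epsilon>) ^ 2 \<le> (real M + 2) ^ 2"
    by linarith
  then have "real d \<le> ((real M + 2) / (1 / 2 - \<epsilon>)) ^ 2"
    using \<epsilon>(2) by (simp add: power_divide pos_le_divide_eq)
  with d show False by linarith
qed

section \<open>Indiscernible sequences\<close>

definition incr :: "nat \<Rightarrow> nat \<Rightarrow> nat list \<Rightarrow> bool" where
  "incr L r xs \<longleftrightarrow> sorted_wrt (<) xs \<and> set xs \<subseteq> {..<L} \<and> length xs = r"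

lemma incr_map:
  assumes "strict_mono_on {..<L} f" and "f ` {..<L} \<subseteq> {..<N}" and "incr L r xs"
  shows "incr N r (map f xs)"
proof -
  have "sorted_wrt (<) (map f xs)"
    unfolding sorted_wrt_map
    by (rule sorted_wrt_mono_rel[of _ "(<)"]) (use assms in \<open>auto simp: incr_def strict_mono_on_def subset_iff\<close>)
  with assms(2,3) show ?thesis
    by (auto simp: incr_def)
qed

text \<open>Ramsey's theorem for \<open>r\<close>-subsets and two colours, with increasing lists in
  place of sets; \<open>f\<close> enumerates the homogeneous set. The length \<open>N\<close> is
  chosen before the relation \<open>P\<close>.\<close>

lemma homogeneous_subsequence:
  "\<exists>N. \<forall>P :: nat list \<Rightarrow> bool. \<exists>f. strict_mono_on {..<L} f \<and> f ` {..<L} \<subseteq> {..<N} \<and>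
    (\<forall>xs ys. incr L r xs \<longrightarrow> incr L r ys \<longrightarrow> P (map f xs) = P (map f ys))"
proof -
  obtain N :: nat where N: "partn_lst {..<N} [L, L] r"
    using ramsey_full by blast
  have "\<exists>f. strict_mono_on {..<L} f \<and> f ` {..<L} \<subseteq> {..<N} \<and>
    (\<forall>xs ys. incr L r xs \<longrightarrow> incr L r ys \<longrightarrow> P (map f xs) = P (map f ys))" for P :: "nat list \<Rightarrow> bool"
  proof -
    define col where "col R = (if P (sorted_list_of_set R) then 0 else 1 :: nat)" for R
    have "col \<in> nsets {..<N} r \<rightarrow> {..<length [L, L]}"
      by (auto simp: col_def)
    with N obtain i where i: "i < length [L, L]" "monochromatic {..<N} ([L, L] ! i) r col i"
      unfolding partn_lst_def by blast
    moreover have "[L, L] ! i = L"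
      using i(1) by (auto simp: less_Suc_eq)
    ultimately obtain H where H: "H \<in> nsets {..<N} L" "col ` nsets H r \<subseteq> {i}"
      unfolding monochromatic_def by auto
    have fin: "finite H" "card H = L" "H \<subseteq> {..<N}"
      using H(1) by (auto simp: nsets_def)
    define f where "f j = sorted_list_of_set H ! j" for j
    have mono: "strict_mono_on {..<L} f"
      using fin sorted_wrt_nth_less[OF strict_sorted_list_of_set[of H]]
      by (intro strict_mono_onI) (auto simp: f_def)
    have img: "f ` {..<L} \<subseteq> H"
    proof
      fix z assume "z \<in> f ` {..<L}"
      then have "z \<in> set (sorted_list_of_set H)"
        using fin by (auto simp: f_def simp del: set_sorted_list_of_set)
      then show "z \<in> H" using fin by simp
    qed
    have "(if P (map f xs) then 0 else 1) = i" if xs: "incr L r xs" for xs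
    proof -
      have inc: "incr N r (map f xs)"
        using incr_map[OF mono _ xs] img fin(3) by blast
      then have eq: "sorted_list_of_set (set (map f xs)) = map f xs"
        by (intro sorted_list_of_set.idem_if_sorted_distinct)
          (auto simp: incr_def strict_sorted_iff)
      have "distinct (map f xs)"
        using inc by (auto simp: incr_def strict_sorted_iff)
      then have "card (set (map f xs)) = r"
        using inc distinct_card[of "map f xs"] by (simp add: incr_def)
      then have "set (map f xs) \<in> nsets H r"
        using xs img by (auto simp: nsets_def incr_def)
      then have "col (set (map f xs)) = i"
        using H(2) by blast
      then show ?thesis
        unfolding col_def eq .
    qed
    then have "\<forall>xs ys. incr L r xs \<longrightarrow> incr L r ys \<longrightarrow> P (map f xs) = P (map f ys)"
      by (metis zero_neq_one)
    with mono img fin(3) show ?thesis by blast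
  qed
  then show ?thesis by blast
qed

lemma strict_mono_on_comp:
  assumes "strict_mono_on {..<L} g" and "g ` {..<L} \<subseteq> {..<N}" and "strict_mono_on {..<N} f"
  shows "strict_mono_on {..<L} (f \<circ> g)"
  using assms by (auto simp: strict_mono_on_def subset_iff)

text \<open>One relation at a time: homogeneity for the new relation on a subsequence of length
  \<open>N1\<close> survives the further thinning that serves the other relations.\<close>

lemma indiscernible_subsequence:
  assumes "finite T"
  shows "\<exists>N. \<forall>P :: 'i \<Rightarrow> nat list \<Rightarrow> bool. \<exists>f. strict_mono_on {..<L} f \<and> f ` {..<L} \<subseteq> {..<N} \<and>
    (\<forall>\<tau>\<in>T. \<forall>xs ys. incr L (ar \<tau>) xs \<longrightarrow> incr L (ar \<tau>) ys \<longrightarrow> P \<tau> (map f xs) = P \<tau> (map f ys))"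
  using assms
proof (induction T)
  case empty
  show ?case
    by (intro exI[of _ L] allI exI[of _ id]) (auto simp: strict_mono_on_def)
next
  case (insert \<tau> T)
  then obtain N1 where N1: "\<And>P :: 'i \<Rightarrow> nat list \<Rightarrow> bool. \<exists>f. strict_mono_on {..<L} f \<and> f ` {..<L} \<subseteq> {..<N1} \<and>
    (\<forall>\<tau>\<in>T. \<forall>xs ys. incr L (ar \<tau>) xs \<longrightarrow> incr L (ar \<tau>) ys \<longrightarrow> P \<tau> (map f xs) = P \<tau> (map f ys))"
    by blast
  obtain N where N: "\<And>P :: nat list \<Rightarrow> bool. \<exists>f. strict_mono_on {..<N1} f \<and> f ` {..<N1} \<subseteq> {..<N} \<and>
    (\<forall>xs ys. incr N1 (ar \<tau>) xs \<longrightarrow> incr N1 (ar \<tau>) ys \<longrightarrow> P (map f xs) = P (map f ys))"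
    using homogeneous_subsequence[of N1 "ar \<tau>"] by blast
  have "\<exists>f. strict_mono_on {..<L} f \<and> f ` {..<L} \<subseteq> {..<N} \<and>
    (\<forall>\<sigma>\<in>insert \<tau> T. \<forall>xs ys. incr L (ar \<sigma>) xs \<longrightarrow> incr L (ar \<sigma>) ys \<longrightarrow> P \<sigma> (map f xs) = P \<sigma> (map f ys))"
    for P :: "'i \<Rightarrow> nat list \<Rightarrow> bool"
  proof -
    obtain f where f: "strict_mono_on {..<N1} f" "f ` {..<N1} \<subseteq> {..<N}"
      and fP: "\<And>xs ys. incr N1 (ar \<tau>) xs \<Longrightarrow> incr N1 (ar \<tau>) ys \<Longrightarrow> P \<tau> (map f xs) = P \<tau> (map f ys)"
      using N[of "P \<tau>"] by blast
    obtain g where g: "strict_mono_on {..<L} g" "g ` {..<L} \<subseteq> {..<N1}"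
      and gP: "\<forall>\<sigma>\<in>T. \<forall>xs ys. incr L (ar \<sigma>) xs \<longrightarrow> incr L (ar \<sigma>) ys \<longrightarrow>
        P \<sigma> (map f (map g xs)) = P \<sigma> (map f (map g ys))"
      using N1[of "\<lambda>\<sigma> xs. P \<sigma> (map f xs)"] by (elim exE conjE) (rule that)
    show ?thesis
    proof (intro exI[of _ "f \<circ> g"] conjI ballI allI impI)
      show "strict_mono_on {..<L} (f \<circ> g)"
        using strict_mono_on_comp[OF g f(1)] .
      show "(f \<circ> g) ` {..<L} \<subseteq> {..<N}"
        using f(2) g(2) by auto
      fix \<sigma> xs ys assume \<sigma>: "\<sigma> \<in> insert \<tau> T" and xs: "incr L (ar \<sigma>) xs" and ys: "incr L (ar \<sigma>) ys"
      show "P \<sigma> (map (f \<circ> g) xs) = P \<sigma> (map (f \<circ> g) ys)"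
      proof (cases "\<sigma> = \<tau>")
        case True
        then show ?thesis
          using fP[OF incr_map[OF g] incr_map[OF g]] xs ys unfolding map_map by blast
      next
        case False
        then show ?thesis
          using gP[rule_format, OF _ xs ys] \<sigma> unfolding map_map by blast
      qed
    qed
  qed
  then show ?case by blast
qed

section \<open>Affine connectedness and stability\<close>

text \<open>Linear independence over the field with two elements, where linear combinations are
  subset sums.\<close>

definition indep_seq :: "nat \<Rightarrow> (nat \<Rightarrow> nat \<Rightarrow> bit) \<Rightarrow> bool" where
  "indep_seq N u \<longleftrightarrow> (\<forall>S\<subseteq>{..<N}. S \<noteq> {} \<longrightarrow> (\<Sum>i\<in>S. u i) \<noteq> 0)"

lemma indep_seq_comp:
  assumes "indep_seq N u" and "inj_on f {..<L}" and "f ` {..<L} \<subseteq> {..<N}"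
  shows "indep_seq L (u \<circ> f)"
  unfolding indep_seq_def
proof (intro allI impI)
  fix S assume S: "S \<subseteq> {..<L}" "S \<noteq> {}"
  have "(\<Sum>i\<in>S. (u \<circ> f) i) = (\<Sum>i\<in>f ` S. u i)"
    using sum.reindex[OF inj_on_subset[OF assms(2) S(1)], of u] by simp
  moreover have "(\<Sum>i\<in>f ` S. u i) \<noteq> 0"
    using assms(1,3) S unfolding indep_seq_def by (meson image_is_empty image_mono order_trans)
  ultimately show "(\<Sum>i\<in>S. (u \<circ> f) i) \<noteq> 0" by simp
qed

lemma indep_seq_inj:
  assumes "indep_seq N u"
  shows "inj_on u {..<N}"
proof (rule inj_onI, rule ccontr)
  fix i j assume *: "i \<in> {..<N}" "j \<in> {..<N}" "u i = u j" "i \<noteq> j"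
  then have "(\<Sum>i\<in>{i, j}. u i) = 0"
    by simp
  with * assms show False
    unfolding indep_seq_def by (metis empty_not_insert insert_subset empty_subsetI)
qed

lemma sum_constant_bit:
  fixes y :: "nat \<Rightarrow> bit"
  assumes "finite S"
  shows "(\<Sum>i\<in>S. y) = (if odd (card S) then y else 0)"
  using assms by (induction S) (auto simp del: sum_constant)

text \<open>Affine connectedness is applied to the \<open>k + 1\<close> block sums shifted by
  \<open>y\<close>. The conclusion is put in terms of odd combinations of blocks because these keep
  exactly one copy of \<open>y\<close>.\<close>

lemma affine_connected_blocks:
  fixes u :: "nat \<Rightarrow> nat \<Rightarrow> bit" and y :: "nat \<Rightarrow> bit"
  assumes conn: "affine_connected k C" and indep: "indep_seq L u"
    and L: "(k + 1) * r \<le> L" and r: "r > 0"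
    and C: "\<And>i. i \<le> k \<Longrightarrow> y + (\<Sum>j\<in>{i * r..<(i + 1) * r}. u j) \<in> C"
  obtains T where "T \<subseteq> {..k}" and "odd (card T)" and "card T \<ge> 3"
    and "y + (\<Sum>j\<in>(\<Union>i\<in>T. {i * r..<(i + 1) * r}). u j) \<in> C"
proof -
  define blk where "blk i = {i * r..<(i + 1) * r}" for i
  define P where "P i = y + (\<Sum>j\<in>blk i. u j)" for i
  define a where "a i = (if i = 0 then P 0 else P 0 + P i)" for i
  have disj: "blk i \<inter> blk j = {}" if "i \<noteq> j" for i j
  proof -
    have "blk i \<inter> blk j = {}" if "i < j" for i j
    proof -
      have "(i + 1) * r \<le> j * r" using that by (intro mult_le_mono1) simp
      then show ?thesis unfolding blk_def by auto
    qed
    with \<open>i \<noteq> j\<close> show ?thesis by (metis inf_commute nat_neq_iff)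
  qed
  have sub: "blk i \<subseteq> {..<L}" if "i \<le> k" for i
  proof -
    have "(i + 1) * r \<le> (k + 1) * r" using that by (intro mult_le_mono1) simp
    then have "(i + 1) * r \<le> L" using L by linarith
    then show ?thesis unfolding blk_def by auto
  qed
  have sumP: "(\<Sum>i\<in>S. P i) = (if odd (card S) then y else 0) + (\<Sum>j\<in>(\<Union>i\<in>S. blk i). u j)"
    if "finite S" for S
  proof -
    have "(\<Sum>j\<in>(\<Union>i\<in>S. blk i). u j) = (\<Sum>i\<in>S. \<Sum>j\<in>blk i. u j)"
      using disj that by (intro sum.UNION_disjoint) (auto simp: blk_def)
    then show ?thesis
      by (simp add: P_def sum.distrib sum_constant_bit[OF that] del: sum_constant)
  qed
  have P: "P i \<in> C" if "i \<le> k" for i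
    using C[OF that] unfolding P_def blk_def .
  have a: "a 0 = P 0" "\<And>i. i \<noteq> 0 \<Longrightarrow> a i = P 0 + P i"
    by (simp_all add: a_def)
  have indepP: "\<not> affinely_dependent k (\<lambda>i. if i = 0 then a 0 else a 0 + a i)"
  proof
    assume dep: "affinely_dependent k (\<lambda>i. if i = 0 then a 0 else a 0 + a i)"
    have eq: "(if i = 0 then a 0 else a 0 + a i) = P i" for i
      by (simp add: a_def)
    obtain c :: "nat \<Rightarrow> bit" where c: "\<exists>i\<le>k. c i \<noteq> 0" "(\<Sum>i\<le>k. c i) = 0" "(\<Sum>i\<le>k. scale (c i) (P i)) = 0"
      using dep unfolding affinely_dependent_def eq by blast
    \<comment> \<open>The support of a dependence has even size, so the copies of \<open>y\<close>
      cancel and a nonempty subset sum of \<open>u\<close> would vanish.\<close>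
    define S where "S = {i. i \<le> k \<and> c i \<noteq> 0}"
    have S: "finite S" "S \<noteq> {}" "S \<subseteq> {..k}"
      using c(1) by (auto simp: S_def)
    have "(\<Sum>i\<le>k. c i) = (\<Sum>i\<in>S. 1)"
      by (rule sum.mono_neutral_cong_right) (auto simp: S_def)
    then have "of_nat (card S) = (0 :: bit)"
      using c(2) by simp
    moreover have "even (of_nat (card S) :: bit) \<longleftrightarrow> even (card S)"
      by (rule even_of_nat_iff)
    ultimately have "even (card S)"
      by (simp only: even_zero)
    moreover have "(\<Sum>i\<le>k. scale (c i) (P i)) = (\<Sum>i\<in>S. P i)"
      by (rule sum.mono_neutral_cong_right) (auto simp: S_def scale_def zero_fun_def)
    ultimately have "(\<Sum>j\<in>(\<Union>i\<in>S. blk i). u j) = 0"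
      using c(3) sumP[OF S(1)] by simp
    moreover have "(\<Union>i\<in>S. blk i) \<subseteq> {..<L}"
      using S(3) sub by blast
    moreover have "(\<Union>i\<in>S. blk i) \<noteq> {}"
      using S(2) r by (auto simp: blk_def)
    ultimately show False
      using indep unfolding indep_seq_def by blast
  qed
  have "a 0 \<in> C \<and> (\<forall>i\<in>{1..k}. a 0 + a i \<in> C)"
    using P by (auto simp: a_def)
  then obtain T where T: "T \<subseteq> {1..k}" "card T \<ge> 2" "a 0 + (\<Sum>i\<in>T. a i) \<in> C"
    using conn indepP unfolding affine_connected_def by blast
  have finT: "finite T" and "0 \<notin> T"
    using T(1) finite_subset by auto
  \<comment> \<open>Every \<open>a i\<close> with \<open>i > 0\<close> contains \<open>P 0\<close>.
    Together with \<open>a 0\<close> these copies cancel when \<open>card T\<close> is odd and leave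
    one \<open>P 0\<close> when it is even, so an odd number of the \<open>P i\<close>
    remains.\<close>
  define T' where "T' = (if odd (card T) then T else insert 0 T)"
  have "(\<Sum>i\<in>T. a i) = (\<Sum>i\<in>T. P 0 + P i)"
    using \<open>0 \<notin> T\<close> by (intro sum.cong refl) (auto simp: a_def)
  also have "\<dots> = (if odd (card T) then P 0 else 0) + (\<Sum>i\<in>T. P i)"
    using finT by (simp add: sum.distrib sum_constant_bit del: sum_constant)
  finally have "a 0 + (\<Sum>i\<in>T. a i) = (\<Sum>i\<in>T'. P i)"
    using finT \<open>0 \<notin> T\<close> by (simp add: a_def T'_def)
  also have "\<dots> = y + (\<Sum>j\<in>(\<Union>i\<in>T'. blk i). u j)"
    using finT \<open>0 \<notin> T\<close> by (subst sumP) (auto simp: T'_def)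
  finally have "y + (\<Sum>j\<in>(\<Union>i\<in>T'. blk i). u j) \<in> C"
    using T(3) by simp
  moreover have "T' \<subseteq> {..k}" "odd (card T')"
    using finT \<open>0 \<notin> T\<close> T(1) by (auto simp: T'_def)
  moreover have "card T' \<ge> 3"
  proof (cases "odd (card T)")
    case True
    then have "card T \<noteq> 2" by auto
    then show ?thesis using True T(2) by (simp add: T'_def)
  next
    case False
    then show ?thesis using finT \<open>0 \<notin> T\<close> T(2) by (simp add: T'_def)
  qed
  ultimately show ?thesis
    using that unfolding blk_def by blast
qed

section \<open>Majority sets and their stabilizers\<close>

text \<open>It is used with \<open>card X = 2 * 2 ^ d\<close>. Then membership of \<open>y\<close>
  puts at least \<open>2 ^ d\<close> of the sums \<open>x + y\<close> inside \<open>B\<close>, and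
  non-membership puts at least \<open>2 ^ d\<close> outside. This is the length of a half graph that
  stability forbids.\<close>

definition maj :: "(nat \<Rightarrow> bit) set \<Rightarrow> (nat \<Rightarrow> bit) set \<Rightarrow> (nat \<Rightarrow> bit) set" where
  "maj B X = {y. card X < 2 * card {x \<in> X. x + y \<in> B}}"

definition stab :: "nat \<Rightarrow> (nat \<Rightarrow> bit) set \<Rightarrow> (nat \<Rightarrow> bit) set" where
  "stab n D = {x \<in> cube n. \<forall>y\<in>cube n. x + y \<in> D \<longleftrightarrow> y \<in> D}"

lemma stab_add: "x \<in> stab n D \<Longrightarrow> y \<in> stab n D \<Longrightarrow> x + y \<in> stab n D"
  unfolding stab_def by (simp add: add.assoc)

lemma stab_mem_iff:
  assumes "x \<in> stab n D"
  shows "x \<in> D \<longleftrightarrow> 0 \<in> D"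
proof -
  have "x + 0 \<in> D \<longleftrightarrow> 0 \<in> D"
    using assms cube_zero unfolding stab_def by blast
  then show ?thesis by simp
qed

lemma maj_imp_ex:
  assumes "y \<in> maj B X"
  shows "\<exists>x\<in>X. x + y \<in> B"
proof (rule ccontr)
  assume "\<not> ?thesis"
  then have "{x \<in> X. x + y \<in> B} = {}" by blast
  with assms show False by (simp add: maj_def)
qed

lemma not_maj_imp_ex:
  assumes "y \<notin> maj B X" and "card X > 0"
  shows "\<exists>x\<in>X. x + y \<notin> B"
proof (rule ccontr)
  assume "\<not> ?thesis"
  then have "{x \<in> X. x + y \<in> B} = X" by blast
  with assms show False by (simp add: maj_def)
qed

lemma subspace_stab: "F2.subspace (stab n D)"
  unfolding F2.subspace_def
proof (intro conjI ballI allI)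
  show zero: "0 \<in> stab n D"
    by (simp add: stab_def)
  show "x + y \<in> stab n D" if "x \<in> stab n D" "y \<in> stab n D" for x y
    using that by (rule stab_add)
  show "scale c x \<in> stab n D" if "x \<in> stab n D" for c x
    using that zero by (cases c) simp_all
qed

section \<open>Sums along sequences for a stable and affine connected set\<close>

locale stable_connected =
  fixes n k d :: nat and B :: "(nat \<Rightarrow> bit) set"
  assumes B_sub: "B \<subseteq> cube n"
    and conn: "affine_connected k B"
    and conn_compl: "affine_connected k (cube n - B)"
    and stable: "\<not> shatter n B d (cube n)"
begin

lemma no_halfgraph:
  fixes x y :: "nat \<Rightarrow> nat \<Rightarrow> bit"
  assumes "\<And>i. i < 2 ^ d \<Longrightarrow> x i \<in> cube n" and "\<And>j. j < 2 ^ d \<Longrightarrow> y j \<in> cube n"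
    and "\<And>i j. i < 2 ^ d \<Longrightarrow> j < 2 ^ d \<Longrightarrow> x i + y j \<in> B \<longleftrightarrow> (i < j) = c"
  shows False
proof -
  have "shatter n B d (x ` {..<2 ^ d})"
    using assms(2,3) by (rule halfgraph_shatter)
  then have "shatter n B d (cube n)"
    using assms(1) by (elim shatter_mono) auto
  with stable show False ..
qed

text \<open>Adding \<open>u i\<close> to a sum of \<open>r + 1\<close> terms leaves \<open>r\<close>
  or \<open>r + 2\<close> terms, depending on whether \<open>i\<close> already occurs. If the two
  lengths had different values, this would encode an order.\<close>

lemma sums_step_two:
  assumes y: "y \<in> cube n" and u: "\<And>i. i < L \<Longrightarrow> u i \<in> cube n"
    and s: "\<And>S. S \<subseteq> {..<L} \<Longrightarrow> y + (\<Sum>i\<in>S. u i) \<in> B \<longleftrightarrow> s (card S)"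
    and r: "2 ^ d \<le> r + 1" "r + 1 + 2 ^ d \<le> L"
  shows "s r = s (r + 2)"
proof (rule ccontr)
  assume neq: "s r \<noteq> s (r + 2)"
  \<comment> \<open>The indices below \<open>j\<close>, padded to \<open>r + 1\<close> elements by
    indices from \<open>2 ^ d\<close> on, so that for \<open>i < 2 ^ d\<close> membership of
    \<open>i\<close> means \<open>i < j\<close>. The padding needs
    \<open>j \<le> r + 1\<close>.\<close>
  define Y where "Y j = {..<j} \<union> {2 ^ d..<2 ^ d + (r + 1 - j)}" for j :: nat
  have Y: "Y j \<subseteq> {..<L}" "finite (Y j)" "card (Y j) = r + 1" if "j < 2 ^ d" for j
  proof -
    have "card (Y j) = card {..<j} + card {2 ^ d..<2 ^ d + (r + 1 - j)}"
      unfolding Y_def using that by (intro card_Un_disjoint) auto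
    then show "card (Y j) = r + 1"
      using that r(1) by simp
  qed (use that r in \<open>auto simp: Y_def\<close>)
  show False
  proof (rule no_halfgraph[of u "\<lambda>j. y + (\<Sum>i\<in>Y j. u i)" "s r"])
    show "u i \<in> cube n" if "i < 2 ^ d" for i
      using u that r by simp
    show "y + (\<Sum>i\<in>Y j. u i) \<in> cube n" if "j < 2 ^ d" for j
      using Y(1)[OF that] by (intro cube_add y cube_sum u) auto
    fix i j :: nat assume i: "i < 2 ^ d" and j: "j < 2 ^ d"
    show "u i + (y + (\<Sum>i\<in>Y j. u i)) \<in> B \<longleftrightarrow> (i < j) = s r"
    proof (cases "i < j")
      case True
      then have "i \<in> Y j" by (auto simp: Y_def)
      then have "(\<Sum>i\<in>Y j. u i) = u i + (\<Sum>i\<in>Y j - {i}. u i)"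
        using Y(2)[OF j] by (simp add: sum.remove)
      then have e: "u i + (y + (\<Sum>i\<in>Y j. u i)) = y + (\<Sum>i\<in>Y j - {i}. u i)"
        by (simp only: add.left_commute add_self_left)
      have "card (Y j - {i}) = r"
        using \<open>i \<in> Y j\<close> Y(2,3)[OF j] by simp
      moreover have "Y j - {i} \<subseteq> {..<L}"
        using Y(1)[OF j] by blast
      ultimately show ?thesis
        unfolding e using s[of "Y j - {i}"] True by simp
    next
      case False
      then have "i \<notin> Y j" using i by (auto simp: Y_def)
      then have e: "u i + (y + (\<Sum>i\<in>Y j. u i)) = y + (\<Sum>i\<in>insert i (Y j). u i)"
        using Y(2)[OF j] by (simp add: add.left_commute)
      have "card (insert i (Y j)) = r + 2"
        using \<open>i \<notin> Y j\<close> Y(2,3)[OF j] by simp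
      moreover have "insert i (Y j) \<subseteq> {..<L}"
        using Y(1)[OF j] i r(2) by simp
      ultimately show ?thesis
        unfolding e using s[of "insert i (Y j)"] False neq by simp
    qed
  qed
qed

text \<open>Stability makes the value constant on odd lengths from \<open>2 * 2 ^ d + 1\<close> on.
  Affine connectedness handles shorter lengths, since it lifts an exceptional length to a larger odd
  one.\<close>

lemma odd_sums_const:
  assumes y: "y \<in> cube n" and u: "\<And>i. i < L \<Longrightarrow> u i \<in> cube n" and indep: "indep_seq L u"
    and s: "\<And>S. S \<subseteq> {..<L} \<Longrightarrow> y + (\<Sum>i\<in>S. u i) \<in> B \<longleftrightarrow> s (card S)"
    and L: "(k + 1) * (2 * 2 ^ d + 1) + 2 ^ d \<le> L"
    and r: "odd r" "r + 2 ^ d \<le> L"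
  shows "s r = s 1"
proof -
  define \<rho> :: nat where "\<rho> = 2 * 2 ^ d + 1"
  have large: "s (\<rho> + 2 * t) = s \<rho>" if "\<rho> + 2 * t + 2 ^ d \<le> L" for t
    using that
  proof (induction t)
    case (Suc t)
    have "s (\<rho> + 2 * t) = s (\<rho> + 2 * t + 2)"
      using Suc.prems by (intro sums_step_two[OF y u s]) (auto simp: \<rho>_def)
    with Suc show ?case by simp
  qed simp
  have large': "s r = s \<rho>" if r: "odd r" "\<rho> \<le> r" "r + 2 ^ d \<le> L" for r
  proof -
    have "even (r - \<rho>)" using r by (simp add: \<rho>_def)
    then obtain t where "r - \<rho> = 2 * t" by blast
    then have "r = \<rho> + 2 * t" using r(2) by simp
    with large[of t] r(3) show ?thesis by simp
  qed
  text \<open>If the eventual value is \<open>\<not> c\<close>, a maximal exceptional \<open>r\<close> gives \<open>k + 1\<close> blocks of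
    length \<open>r\<close> no odd combination of which, of at least three blocks, has value \<open>c\<close>.\<close>
  have no_exception: "s r \<noteq> c" if c: "s \<rho> \<noteq> c" and r: "odd r" "r + 2 ^ d \<le> L" for c r
  proof
    assume "s r = c"
    define R where "R = {r. odd r \<and> r + 2 ^ d \<le> L \<and> s r = c}"
    have finR: "finite R"
      by (rule finite_subset[of _ "{..L}"]) (auto simp: R_def)
    define r0 where "r0 = Max R"
    have "r \<in> R" using r \<open>s r = c\<close> by (simp add: R_def)
    then have "r0 \<in> R" using finR Max_in unfolding r0_def by blast
    then have r0: "odd r0" "r0 + 2 ^ d \<le> L" "s r0 = c" by (auto simp: R_def)
    have "r0 < \<rho>" using large'[of r0] r0 c by (metis not_less)
    define C where "C = (if c then B else cube n - B)"
    have mem: "y + (\<Sum>i\<in>S. u i) \<in> C \<longleftrightarrow> s (card S) = c" if "S \<subseteq> {..<L}" for S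
    proof -
      have "y + (\<Sum>i\<in>S. u i) \<in> cube n"
        using that by (intro cube_add y cube_sum u) auto
      with s[OF that] show ?thesis by (auto simp: C_def)
    qed
    have len: "(k + 1) * r0 + 2 ^ d \<le> L"
    proof -
      have "(k + 1) * r0 \<le> (k + 1) * \<rho>" using \<open>r0 < \<rho>\<close> by (intro mult_le_mono2) simp
      with L show ?thesis unfolding \<rho>_def by linarith
    qed
    have blk: "{i * r0..<(i + 1) * r0} \<subseteq> {..<L}" if "i \<le> k" for i
    proof -
      have "(i + 1) * r0 \<le> (k + 1) * r0" using that by (intro mult_le_mono1) simp
      then have "(i + 1) * r0 \<le> L" using len by linarith
      then show ?thesis by auto
    qed
    have "affine_connected k C"
      using conn conn_compl by (simp add: C_def)
    moreover have "(k + 1) * r0 \<le> L" "r0 > 0"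
      using len r0(1) by (auto intro: Nat.gr0I)
    moreover have "y + (\<Sum>j\<in>{i * r0..<(i + 1) * r0}. u j) \<in> C" if "i \<le> k" for i
      using mem[OF blk[OF that]] r0(3) by simp
    ultimately obtain T where T: "T \<subseteq> {..k}" "odd (card T)" "card T \<ge> 3"
      "y + (\<Sum>j\<in>(\<Union>i\<in>T. {i * r0..<(i + 1) * r0}). u j) \<in> C"
      using indep by (elim affine_connected_blocks) auto
    have "card (\<Union>i\<in>T. {i * r0..<(i + 1) * r0}) = (\<Sum>i\<in>T. card {i * r0..<(i + 1) * r0})"
    proof (rule card_UN_disjoint)
      show "finite T" using T(1) finite_subset by auto
      show "\<forall>i\<in>T. \<forall>j\<in>T. i \<noteq> j \<longrightarrow> {i * r0..<(i + 1) * r0} \<inter> {j * r0..<(j + 1) * r0} = {}"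
      proof (intro ballI impI)
        have *: "{i * r0..<(i + 1) * r0} \<inter> {j * r0..<(j + 1) * r0} = {}" if "i < j" for i j
        proof -
          have "(i + 1) * r0 \<le> j * r0" using that by (intro mult_le_mono1) simp
          then show ?thesis by auto
        qed
        fix i j :: nat assume "i \<noteq> j"
        then show "{i * r0..<(i + 1) * r0} \<inter> {j * r0..<(j + 1) * r0} = {}"
          using *[of i j] *[of j i] by (metis inf_commute nat_neq_iff)
      qed
    qed auto
    then have card: "card (\<Union>i\<in>T. {i * r0..<(i + 1) * r0}) = card T * r0"
      by simp
    have "(\<Union>i\<in>T. {i * r0..<(i + 1) * r0}) \<subseteq> {..<L}"
      using T(1) blk by blast
    with T(4) mem card have "s (card T * r0) = c" by metis
    moreover have "odd (card T * r0)"
      using T(2) r0(1) by simp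
    moreover have "card T * r0 + 2 ^ d \<le> L"
    proof -
      have "card T \<le> k + 1" using card_mono[OF _ T(1)] by simp
      then have "card T * r0 \<le> (k + 1) * r0" by (rule mult_le_mono1)
      with len show ?thesis by linarith
    qed
    ultimately have "card T * r0 \<in> R" by (simp add: R_def)
    then have "card T * r0 \<le> r0" using finR by (simp add: r0_def)
    with T(3) \<open>r0 > 0\<close> show False by simp
  qed
  have "2 * 2 ^ d + 1 \<le> (k + 1) * (2 * 2 ^ d + 1)"
    by simp
  then have "1 + 2 ^ d \<le> L"
    using L by linarith
  then have "s r = s \<rho>" "s 1 = s \<rho>"
    using no_exception[of "\<not> s \<rho>" r] no_exception[of "\<not> s \<rho>" 1] r by auto
  then show ?thesis by simp
qed

text \<open>On an indiscernible sequence a parameter that takes the value \<open>c\<close> at many of the first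
  \<open>m\<close> positions takes it at all later ones: otherwise, interleaving fresh elements after a
  prefix, one finds a half graph.\<close>

lemma cut_const:
  assumes w: "\<And>xs. incr L q xs \<Longrightarrow> w xs \<in> cube n" and v: "\<And>i. i < L \<Longrightarrow> v i \<in> cube n"
    and L: "(q + 1) * (q + 1) \<le> L" and mq: "m \<le> q"
    and hom: "\<And>xs i. incr L q xs \<Longrightarrow> i < m \<Longrightarrow> v (xs ! i) + w xs \<in> B \<longleftrightarrow> Q i"
    and hom': "\<And>xs i. incr L q xs \<Longrightarrow> \<forall>x\<in>set xs. x < i \<Longrightarrow> i < L \<Longrightarrow> v i + w xs \<in> B \<longleftrightarrow> \<beta>"
    and card: "card {i. i < m \<and> Q i = c} \<ge> 2 ^ d"
  shows "\<beta> = c"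
proof (rule ccontr)
  assume neq: "\<beta> \<noteq> c"
  define S where "S = {i. i < m \<and> Q i = c}"
  define p where "p i = sorted_list_of_set S ! i" for i
  have finS: "finite S" by (simp add: S_def)
  have pS: "p i \<in> S" if "i < 2 ^ d" for i
  proof -
    have "p i \<in> set (sorted_list_of_set S)"
      using that card unfolding p_def by (intro nth_mem) (simp add: S_def)
    then show ?thesis using finS by simp
  qed
  have p: "p i < m" "Q (p i) = c" if "i < 2 ^ d" for i
    using pS[OF that] by (auto simp: S_def)
  have p_less: "p i < p j" if "i < j" "j < 2 ^ d" for i j
    using that card sorted_wrt_nth_less[OF strict_sorted_list_of_set[of S], of i j]
    by (simp add: p_def S_def)
  \<comment> \<open>The first \<open>p t\<close> entries are multiples of \<open>q + 1\<close>; the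
    others fill the gap just above \<open>(q + 1) * p t\<close>. Hence the grid point
    \<open>g i\<close> is entry number \<open>p i\<close> of \<open>X t\<close> if
    \<open>i < t\<close>, and exceeds all entries otherwise.\<close>
  define X where "X t = map (\<lambda>j. if j < p t then (q + 1) * (j + 1) else (q + 1) * p t + (j - p t) + 1) [0..<q]" for t
  define g where "g i = (q + 1) * (p i + 1)" for i
  have gL: "g i < L" if "i < 2 ^ d" for i
  proof -
    have "g i \<le> (q + 1) * q"
      unfolding g_def using p(1)[OF that] mq by (intro mult_le_mono2) simp
    with L show ?thesis by simp
  qed
  have entry: "X t ! j < g t" if "j < q" for t j
  proof (cases "j < p t")
    case True
    then have "(q + 1) * (j + 1) \<le> (q + 1) * p t" by (intro mult_le_mono2) simp
    with True that show ?thesis by (simp add: X_def g_def)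
  next
    case False
    with that show ?thesis by (simp add: X_def g_def)
  qed
  have incrX: "incr L q (X t)" if t: "t < 2 ^ d" for t
    unfolding incr_def
  proof (intro conjI)
    show "length (X t) = q" by (simp add: X_def)
    show "set (X t) \<subseteq> {..<L}"
    proof
      fix z assume "z \<in> set (X t)"
      then obtain j where "j < q" "z = X t ! j" by (auto simp: in_set_conv_nth X_def)
      then show "z \<in> {..<L}" using entry[of j t] gL[OF t] by simp
    qed
    show "sorted_wrt (<) (X t)"
      unfolding sorted_wrt_iff_nth_less
    proof (intro allI impI)
      fix i j assume ij: "i < j" "j < length (X t)"
      then have jq: "j < q" by (simp add: X_def)
      have Xi: "X t ! i = (if i < p t then (q + 1) * (i + 1) else (q + 1) * p t + (i - p t) + 1)"
        and Xj: "X t ! j = (if j < p t then (q + 1) * (j + 1) else (q + 1) * p t + (j - p t) + 1)"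
        using ij(1) jq by (simp_all add: X_def del: mult_Suc mult_Suc_right)
      consider "j < p t" | "i < p t" "\<not> j < p t" | "\<not> i < p t" by linarith
      then show "X t ! i < X t ! j"
      proof cases
        case 1
        moreover have "(q + 1) * (i + 1) < (q + 1) * (j + 1)"
          using ij(1) by (intro mult_less_mono2) auto
        ultimately show ?thesis using ij(1) Xi Xj by simp
      next
        case 2
        then have "(q + 1) * (i + 1) \<le> (q + 1) * p t" by (intro mult_le_mono2) simp
        then show ?thesis using 2 Xi Xj by simp
      next
        case 3
        then show ?thesis using ij(1) Xi Xj by simp
      qed
    qed
  qed
  show False
  proof (rule no_halfgraph[of "\<lambda>i. v (g i)" "\<lambda>t. w (X t)" c])
    show "v (g i) \<in> cube n" if "i < 2 ^ d" for i
      using v gL that by blast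
    show "w (X t) \<in> cube n" if "t < 2 ^ d" for t
      using w incrX that by blast
    fix i t :: nat assume i: "i < 2 ^ d" and t: "t < 2 ^ d"
    show "v (g i) + w (X t) \<in> B \<longleftrightarrow> (i < t) = c"
    proof (cases "i < t")
      case True
      then have "X t ! p i = g i"
        using p_less[OF True t] p(1)[OF i] mq by (simp add: X_def g_def)
      then show ?thesis
        using hom[OF incrX[OF t] p(1)[OF i]] p(2)[OF i] True by simp
    next
      case False
      then have "p t \<le> p i"
        using p_less[of t i] i by (cases "t = i") auto
      then have "g t \<le> g i"
        unfolding g_def by (intro mult_le_mono2) simp
      have "\<forall>x\<in>set (X t). x < g i"
      proof
        fix z assume "z \<in> set (X t)"
        then obtain j where "j < q" "z = X t ! j" by (auto simp: in_set_conv_nth X_def)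
        then show "z < g i" using entry[of j t] \<open>g t \<le> g i\<close> by simp
      qed
      then show ?thesis
        using hom'[OF incrX[OF t] _ gL[OF i]] False neq by simp
    qed
  qed
qed

end

section \<open>A mistake tree from pair sums outside the stabilizer\<close>

context stable_connected
begin

text \<open>The point \<open>y xs\<close> lies in the majority set of the first \<open>m\<close>
  entries and is moved out of it by the sum of the last two; \<open>w False\<close> and
  \<open>w True\<close> are the point before and after the move. When the configuration is
  indiscernible, these witnesses label a mistake tree of depth \<open>d\<close>.\<close>

lemma no_indiscernible_witness:
  fixes v :: "nat \<Rightarrow> nat \<Rightarrow> bit" and y :: "nat list \<Rightarrow> nat \<Rightarrow> bit"
  defines "m \<equiv> 2 * 2 ^ d" and "q \<equiv> 2 * 2 ^ d + 2"
    and "w \<equiv> \<lambda>e xs. y xs + (if e then v (xs ! (2 * 2 ^ d)) + v (xs ! (2 * 2 ^ d + 1)) else 0)"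
  assumes v: "\<And>i. i < L \<Longrightarrow> v i \<in> cube n" and indep: "indep_seq L v"
    and y: "\<And>xs. incr L q xs \<Longrightarrow> y xs \<in> cube n"
    and in_maj: "\<And>xs. incr L q xs \<Longrightarrow> w False xs \<in> maj B (v ` set (take m xs))"
    and not_in_maj: "\<And>xs. incr L q xs \<Longrightarrow> w True xs \<notin> maj B (v ` set (take m xs))"
    and hom: "\<And>e xs i. incr L q xs \<Longrightarrow> i < m \<Longrightarrow> v (xs ! i) + w e xs \<in> B \<longleftrightarrow> Q e i"
    and hom': "\<And>e xs r. incr L (q + r) xs \<Longrightarrow> r \<le> K \<Longrightarrow>
      w e (take q xs) + (\<Sum>i\<in>set (drop q xs). v i) \<in> B \<longleftrightarrow> sg e r"
    and K: "(k + 1) * (2 * 2 ^ d + 1) + 2 ^ d \<le> K" "2 * d + 1 + 2 ^ d \<le> K"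
    and L: "(q + 1) * (q + 1) \<le> L" "q + K \<le> L" "m + 2 * d < L"
  shows False
proof -
  have w: "w e xs \<in> cube n" if xs: "incr L q xs" for e xs
  proof -
    have "xs ! m \<in> set xs" "xs ! (m + 1) \<in> set xs"
      using xs by (auto simp: incr_def q_def m_def)
    then have "v (xs ! m) \<in> cube n" "v (xs ! (m + 1)) \<in> cube n"
      using xs v by (auto simp: incr_def)
    then show ?thesis
      using y[OF xs] by (auto simp: w_def m_def)
  qed
  have append: "incr L (q + card J) (xs @ sorted_list_of_set J)"
    if "incr L q xs" "finite J" "J \<subseteq> {..<L}" "\<And>x j. x \<in> set xs \<Longrightarrow> j \<in> J \<Longrightarrow> x < j" for xs J
    using that by (auto simp: incr_def sorted_wrt_append)
  have later: "w e xs + (\<Sum>i\<in>J. v i) \<in> B \<longleftrightarrow> sg e (card J)"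
    if "incr L q xs" "finite J" "J \<subseteq> {..<L}" "\<And>x j. x \<in> set xs \<Longrightarrow> j \<in> J \<Longrightarrow> x < j" "card J \<le> K" for e xs J
    using hom'[OF append[OF that(1-4)] that(5), of e] that(1,2) by (simp add: incr_def)
  define xs0 where "xs0 = [0..<q]"
  have xs0: "incr L q xs0"
    using L(2) by (auto simp: incr_def xs0_def sorted_wrt_upt)
  \<comment> \<open>The majority counts vectors while \<open>Q\<close> refers to positions.
    Independence makes \<open>v\<close> injective, so the counts agree.\<close>
  have count: "card {x \<in> v ` set (take m xs0). x + w e xs0 \<in> B} = card {i. i < m \<and> Q e i}" for e
  proof -
    have "set (take m xs0) = {..<m}"
      by (auto simp: xs0_def take_upt q_def m_def)
    moreover have "v i + w e xs0 \<in> B \<longleftrightarrow> Q e i" if "i < m" for i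
    proof -
      have "xs0 ! i = i" using that by (simp add: xs0_def q_def m_def del: upt_Suc)
      then show ?thesis using hom[OF xs0 that, of e] by simp
    qed
    then have "{x \<in> v ` {..<m}. x + w e xs0 \<in> B} = v ` {i. i < m \<and> Q e i}"
      by auto
    moreover have "inj_on v {i. i < m \<and> Q e i}"
      using indep_seq_inj[OF indep] L(2) by (elim inj_on_subset) (auto simp: q_def m_def)
    ultimately show ?thesis by (simp add: card_image)
  qed
  have card_X: "card (v ` set (take m xs0)) = m"
  proof -
    have "inj_on v {..<m}"
      using indep_seq_inj[OF indep] L(2) by (elim inj_on_subset) (auto simp: q_def m_def)
    moreover have "set (take m xs0) = {..<m}"
      by (auto simp: xs0_def take_upt q_def m_def)
    ultimately show ?thesis by (simp add: card_image)
  qed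
  have many: "card {i. i < m \<and> Q e i = (\<not> e)} \<ge> 2 ^ d" for e
  proof (cases e)
    case False
    then have "m < 2 * card {i. i < m \<and> Q False i}"
      using in_maj[OF xs0] count[of False] card_X by (simp add: maj_def)
    then show ?thesis using False by (simp add: m_def)
  next
    case True
    have "2 * card {i. i < m \<and> Q True i} \<le> m"
      using not_in_maj[OF xs0] count[of True] card_X by (simp add: maj_def)
    moreover have "card {i. i < m \<and> \<not> Q True i} = m - card {i. i < m \<and> Q True i}"
    proof -
      have "{i. i < m \<and> \<not> Q True i} = {..<m} - {i. i < m \<and> Q True i}" by auto
      then show ?thesis by (simp add: card_Diff_subset subset_iff)
    qed
    ultimately show ?thesis using True by (simp add: m_def)
  qed
  \<comment> \<open>By \<open>cut_const\<close> the majority among the first \<open>m\<close> terms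
    decides for one later term: the sum is in \<open>B\<close> before the move and outside
    \<open>B\<close> after it. \<open>odd_sums_const\<close> then extends this to odd sums of later
    terms.\<close>
  have sg1: "sg e 1 = (\<not> e)" for e
  proof (rule cut_const[OF w v L(1) _ hom _ many])
    show "m \<le> q" by (simp add: m_def q_def)
    fix xs i assume xs: "incr L q xs" and i: "\<forall>x\<in>set xs. x < i" "i < L"
    show "v i + w e xs \<in> B \<longleftrightarrow> sg e 1"
      using later[OF xs, of "{i}" e] i K(2) by (simp add: add.commute)
  qed
  have sg: "sg e r = (\<not> e)" if r: "odd r" "r + 2 ^ d \<le> K" for e r
  proof -
    have "sg e r = sg e 1"
    proof (rule odd_sums_const[of "w e xs0" K "\<lambda>i. v (q + i)"])
      show "w e xs0 \<in> cube n" using w[OF xs0] .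
      show "v (q + i) \<in> cube n" if "i < K" for i using that v L(2) by simp
      show "indep_seq K (\<lambda>i. v (q + i))"
        using indep_seq_comp[OF indep, of "\<lambda>i. q + i" K] L(2) by (auto simp: comp_def inj_on_def image_subset_iff)
      fix S assume S: "S \<subseteq> {..<K}"
      have fin: "finite S" using S finite_subset by auto
      have "(\<Sum>i\<in>S. v (q + i)) = (\<Sum>i\<in>(\<lambda>i. q + i) ` S. v i)"
        by (subst sum.reindex) (auto simp: inj_on_def)
      moreover have "card ((\<lambda>i. q + i) ` S) = card S"
        by (rule card_image) (auto simp: inj_on_def)
      moreover have "card S \<le> K"
        using card_mono[OF _ S] by simp
      moreover have "w e xs0 + (\<Sum>i\<in>(\<lambda>i. q + i) ` S. v i) \<in> B \<longleftrightarrow> sg e (card ((\<lambda>i. q + i) ` S))"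
        if "card S \<le> K"
      proof (rule later[OF xs0])
        show "(\<lambda>i. q + i) ` S \<subseteq> {..<L}" using S L(2) by auto
        show "card ((\<lambda>i. q + i) ` S) \<le> K" using that fin card_image_le le_trans by blast
      qed (use fin in \<open>auto simp: xs0_def\<close>)
      ultimately show "w e xs0 + (\<Sum>i\<in>S. v (q + i)) \<in> B \<longleftrightarrow> sg e (card S)"
        by metis
    qed (use K r in auto)
    then show ?thesis using sg1 by simp
  qed
  \<comment> \<open>Level \<open>l\<close> of the tree decides whether the pair \<open>pr l\<close>
    is used. The extra term \<open>v (m + 2 * d)\<close> after all pairs makes the number of later
    terms odd.\<close>
  define pr where "pr l = v (m + 2 * l) + v (m + 2 * l + 1)" for l
  define xl where "xl l = [0..<m] @ [m + 2 * l, m + 2 * l + 1]" for l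
  have xl: "incr L q (xl l)" if "l < d" for l
    using that L(3) by (auto simp: incr_def xl_def sorted_wrt_append sorted_wrt_upt q_def m_def)
  have w_xl: "w e (xl l) = y (xl l) + (if e then pr l else 0)" for e l
    by (simp add: w_def xl_def pr_def m_def nth_append)
  have pr: "pr l \<in> cube n" if "l < d" for l
    using that L(3) v by (simp add: pr_def)
  have leaf: "w e (xl l) + (v (m + 2 * d) + (\<Sum>l\<in>S. pr l)) \<in> B \<longleftrightarrow> \<not> e"
    if l: "l < d" and S: "S \<subseteq> {l<..<d}" for e l S
  proof -
    have fin: "finite S" using S finite_subset by auto
    define J where "J = insert (m + 2 * d) (\<Union>l\<in>S. {m + 2 * l, m + 2 * l + 1})"
    have notin: "m + 2 * d \<notin> (\<Union>l\<in>S. {m + 2 * l, m + 2 * l + 1})"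
      using S by auto presburger
    have disj: "\<forall>i\<in>S. \<forall>j\<in>S. i \<noteq> j \<longrightarrow> {m + 2 * i, m + 2 * i + 1} \<inter> {m + 2 * j, m + 2 * j + 1} = {}"
      by auto
    have "(\<Sum>i\<in>J. v i) = v (m + 2 * d) + (\<Sum>i\<in>(\<Union>l\<in>S. {m + 2 * l, m + 2 * l + 1}). v i)"
      unfolding J_def using fin notin by (subst sum.insert) auto
    also have "(\<Sum>i\<in>(\<Union>l\<in>S. {m + 2 * l, m + 2 * l + 1}). v i) = (\<Sum>l\<in>S. pr l)"
      using fin disj by (subst sum.UNION_disjoint) (auto simp: pr_def)
    finally have sumJ: "(\<Sum>i\<in>J. v i) = v (m + 2 * d) + (\<Sum>l\<in>S. pr l)" .
    have "card (\<Union>l\<in>S. {m + 2 * l, m + 2 * l + 1}) = (\<Sum>l\<in>S. card {m + 2 * l, m + 2 * l + 1})"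
      using fin disj by (intro card_UN_disjoint) auto
    then have cardJ: "card J = 1 + 2 * card S"
      unfolding J_def using fin notin by (subst card_insert_disjoint) auto
    have "card S \<le> card {l<..<d}" using S by (intro card_mono) auto
    then have "card S \<le> d" by simp
    have "w e (xl l) + (\<Sum>i\<in>J. v i) \<in> B \<longleftrightarrow> sg e (card J)"
    proof (rule later[OF xl[OF l]])
      show "finite J" using fin by (auto simp: J_def)
      show "J \<subseteq> {..<L}" using S L(3) by (auto simp: J_def)
      show "x < j" if "x \<in> set (xl l)" "j \<in> J" for x j
        using that S l by (auto simp: xl_def J_def)
      show "card J \<le> K" using cardJ \<open>card S \<le> d\<close> K(2) by simp
    qed
    also have "sg e (card J) = (\<not> e)"
      using cardJ \<open>card S \<le> d\<close> K(2) by (intro sg) auto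
    finally show ?thesis by (simp add: sumJ)
  qed
  \<comment> \<open>Elements below a node with \<open>j\<close> levels to go, where \<open>c\<close>
    collects the pairs already chosen. The query \<open>c + y (xl l)\<close> cancels
    \<open>c\<close>, so its answer is given by \<open>leaf\<close>, with \<open>e\<close> telling
    whether \<open>pr l\<close> is used.\<close>
  define Z where "Z j c = (\<lambda>S. c + (v (m + 2 * d) + (\<Sum>l\<in>S. pr l))) ` Pow {d - j..<d}" for j c
  have "shatter n B j (Z j c)" if "j \<le> d" "c \<in> cube n" for j c
    using that
  proof (induction j arbitrary: c)
    case 0
    then show ?case by (auto simp: Z_def)
  next
    case (Suc j)
    define l where "l = d - Suc j"
    have l: "l < d" "d - j = Suc l" "d - Suc j = l"
      using Suc.prems(1) by (auto simp: l_def)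
    have Sl: "S \<subseteq> {l<..<d}" if "S \<in> Pow {d - j..<d}" for S
      using that l(2) by auto
    have "Z j c \<subseteq> {z \<in> Z (Suc j) c. z + (c + y (xl l)) \<in> B}"
    proof
      fix z assume "z \<in> Z j c"
      then obtain S where S: "S \<in> Pow {d - j..<d}" and z: "z = c + (v (m + 2 * d) + (\<Sum>l\<in>S. pr l))"
        by (auto simp: Z_def)
      have "z + (c + y (xl l)) = w False (xl l) + (v (m + 2 * d) + (\<Sum>l\<in>S. pr l))"
        unfolding z w_xl by (simp only: add_ac add_self_left if_False add_0_right add_0_left)
      then have "z + (c + y (xl l)) \<in> B"
        using leaf[OF l(1) Sl[OF S], of False] by simp
      moreover have "z \<in> Z (Suc j) c"
        unfolding Z_def z using S l by (intro imageI) auto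
      ultimately show "z \<in> {z \<in> Z (Suc j) c. z + (c + y (xl l)) \<in> B}" by simp
    qed
    then have 1: "shatter n B j {z \<in> Z (Suc j) c. z + (c + y (xl l)) \<in> B}"
      using Suc.IH[of c] Suc.prems shatter_mono by (meson Suc_leD)
    have "Z j (c + pr l) \<subseteq> {z \<in> Z (Suc j) c. z + (c + y (xl l)) \<notin> B}"
    proof
      fix z assume "z \<in> Z j (c + pr l)"
      then obtain S where S: "S \<in> Pow {d - j..<d}"
        and z: "z = c + pr l + (v (m + 2 * d) + (\<Sum>l\<in>S. pr l))"
        by (auto simp: Z_def)
      have "z + (c + y (xl l)) = w True (xl l) + (v (m + 2 * d) + (\<Sum>l\<in>S. pr l))"
        unfolding z w_xl by (simp only: add_ac add_self_left if_True)
      then have "z + (c + y (xl l)) \<notin> B"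
        using leaf[OF l(1) Sl[OF S], of True] by simp
      moreover have "z \<in> Z (Suc j) c"
      proof -
        have "finite S" "l \<notin> S" using S l(2) finite_subset by auto
        then have "z = c + (v (m + 2 * d) + (\<Sum>l\<in>insert l S. pr l))"
          by (simp add: z add_ac)
        then show ?thesis
          unfolding Z_def using S l by (intro image_eqI[of _ _ "insert l S"]) auto
      qed
      ultimately show "z \<in> {z \<in> Z (Suc j) c. z + (c + y (xl l)) \<notin> B}" by simp
    qed
    then have 2: "shatter n B j {z \<in> Z (Suc j) c. z + (c + y (xl l)) \<notin> B}"
      using Suc.IH[of "c + pr l"] Suc.prems pr[OF l(1)] shatter_mono by (meson Suc_leD cube_add)
    have "c + y (xl l) \<in> cube n"
      using Suc.prems(2) y[OF xl[OF l(1)]] by simp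
    with 1 2 show ?case
      unfolding shatter.simps by blast
  qed
  from this[of d 0] have "shatter n B d (Z d 0)" by simp
  moreover have "Z d 0 \<subseteq> cube n"
  proof
    fix z assume "z \<in> Z d 0"
    then obtain S where S: "S \<subseteq> {0..<d}" and z: "z = v (m + 2 * d) + (\<Sum>l\<in>S. pr l)"
      by (auto simp: Z_def)
    show "z \<in> cube n"
      unfolding z using S L(3) by (intro cube_add v cube_sum pr) auto
  qed
  ultimately show False
    using stable shatter_mono by blast
qed

end

text \<open>On an indiscernible subsequence either all pair sums lie in the stabilizer attached to
  earlier terms or none does, and \<open>no_indiscernible_witness\<close> excludes the
  latter.\<close>

lemma pair_sums_in_stab:
  fixes k d L :: nat
  shows "\<exists>N. \<forall>n B. \<forall>u :: nat \<Rightarrow> nat \<Rightarrow> bit. stable_connected n k d B \<longrightarrow> (\<forall>i<N. u i \<in> cube n) \<longrightarrow> indep_seq N u \<longrightarrow>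
    (\<exists>f. strict_mono_on {..<L} f \<and> f ` {..<L} \<subseteq> {..<N} \<and>
      (\<forall>X j j'. card X = 2 * 2 ^ d \<longrightarrow> (\<forall>i\<in>X. i < j) \<longrightarrow> j < j' \<longrightarrow> j' < L \<longrightarrow>
        u (f j) + u (f j') \<in> stab n (maj B (u ` f ` X))))"
proof -
  define m :: nat where "m = 2 * 2 ^ d"
  define q where "q = m + 2"
  \<comment> \<open>\<open>K\<close> dominates both lower bounds on the number of later terms in
    \<open>no_indiscernible_witness\<close>, and \<open>L'\<close> dominates all lengths needed
    there as well as \<open>L\<close>.\<close>
  define K where "K = (k + 1) * (2 * 2 ^ d + 1) + 2 * d + 1 + 2 ^ d"
  define L' where "L' = L + (q + 1) * (q + 1) + q + K + m + 2 * d + 1"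
  define T :: "(nat \<times> nat \<times> bool) set" where "T = {0, 1, 2} \<times> {..K + m} \<times> UNIV"
  define ar :: "nat \<times> nat \<times> bool \<Rightarrow> nat" where "ar = (\<lambda>(a, r, e). if a = 1 then q + r else q)"
  have "finite T" by (simp add: T_def)
  from indiscernible_subsequence[OF this, of L' ar]
  obtain N where N: "\<And>P :: nat \<times> nat \<times> bool \<Rightarrow> nat list \<Rightarrow> bool. \<exists>f. strict_mono_on {..<L'} f \<and> f ` {..<L'} \<subseteq> {..<N} \<and>
    (\<forall>\<tau>\<in>T. \<forall>xs ys. incr L' (ar \<tau>) xs \<longrightarrow> incr L' (ar \<tau>) ys \<longrightarrow> P \<tau> (map f xs) = P \<tau> (map f ys))"
    by blast
  show ?thesis
  proof (intro exI[of _ N] allI impI)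
    fix n B and u :: "nat \<Rightarrow> nat \<Rightarrow> bit"
    assume sc: "stable_connected n k d B" and u: "\<forall>i<N. u i \<in> cube n" and indep: "indep_seq N u"
    define D where "D zs = maj B (u ` set (take m zs))" for zs
    define pr where "pr zs = u (zs ! m) + u (zs ! (m + 1))" for zs
    define good where "good zs \<longleftrightarrow> pr zs \<in> stab n (D zs)" for zs
    \<comment> \<open>A witness is fixed for every index list before thinning, so that statements
      about it become relations on lists to which Ramsey's theorem applies. The value is arbitrary
      where no witness exists.\<close>
    define Y where "Y zs = (SOME y. y \<in> cube n \<and> y \<in> D zs \<and> y + pr zs \<notin> D zs)" for zs
    define W where "W e zs = Y zs + (if e then pr zs else 0)" for e zs
    \<comment> \<open>Tag 0 tests the witness against a term of the prefix, tag 1 against a sum of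
      \<open>r\<close> later terms, and tag 2 whether the pair sum stabilizes. The flag
      \<open>e\<close> says whether the pair is added.\<close>
    define P :: "nat \<times> nat \<times> bool \<Rightarrow> nat list \<Rightarrow> bool" where
      "P = (\<lambda>(a, r, e) zs. if a = 0 then u (zs ! r) + W e zs \<in> B
        else if a = 1 then W e (take q zs) + (\<Sum>i\<leftarrow>drop q zs. u i) \<in> B else good zs)"
    obtain f where f: "strict_mono_on {..<L'} f" "f ` {..<L'} \<subseteq> {..<N}"
      and hom: "\<forall>\<tau>\<in>T. \<forall>xs ys. incr L' (ar \<tau>) xs \<longrightarrow> incr L' (ar \<tau>) ys \<longrightarrow> P \<tau> (map f xs) = P \<tau> (map f ys)"
      using N[of P] by (elim exE conjE) (rule that)
    have hom0: "u (map f xs ! i) + W e (map f xs) \<in> B \<longleftrightarrow> u (map f ys ! i) + W e (map f ys) \<in> B"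
      if "incr L' q xs" "incr L' q ys" "i < m" for xs ys i e
      using hom[rule_format, of "(0, i, e)" xs ys] that by (simp add: T_def ar_def P_def)
    have hom1: "W e (take q (map f xs)) + (\<Sum>i\<leftarrow>drop q (map f xs). u i) \<in> B \<longleftrightarrow>
        W e (take q (map f ys)) + (\<Sum>i\<leftarrow>drop q (map f ys). u i) \<in> B"
      if "incr L' (q + r) xs" "incr L' (q + r) ys" "r \<le> K" for xs ys r e
      using hom[rule_format, of "(1, r, e)" xs ys] that by (simp add: T_def ar_def P_def)
    have hom2: "good (map f xs) = good (map f ys)" if "incr L' q xs" "incr L' q ys" for xs ys
      using hom[rule_format, of "(2, 0, False)" xs ys] that by (simp add: T_def ar_def P_def)
    define xs0 where "xs0 r = [0..<q + r]" for r
    have xs0: "incr L' (q + r) (xs0 r)" if "r \<le> K" for r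
      using that by (auto simp: incr_def xs0_def L'_def sorted_wrt_upt)
    have f_cube: "u (f i) \<in> cube n" if "i < L'" for i
      using u f(2) that by auto
    have all_good: "good (map f xs)" if xs: "incr L' q xs" for xs
    proof (rule ccontr)
      assume "\<not> good (map f xs)"
      \<comment> \<open>Goodness is itself homogeneous, so one bad list makes all lists bad and
        every \<open>Y\<close> a genuine witness.\<close>
      then have bad: "\<not> good (map f xs)" if "incr L' q xs" for xs
        using hom2[OF that xs] by simp
      have Y: "Y (map f xs) \<in> cube n \<and> Y (map f xs) \<in> D (map f xs) \<and> Y (map f xs) + pr (map f xs) \<notin> D (map f xs)"
        if xs: "incr L' q xs" for xs
      proof -
        have "xs ! m \<in> set xs" "xs ! (m + 1) \<in> set xs"
          using xs by (auto simp: incr_def q_def)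
        then have "xs ! m < L'" "xs ! (m + 1) < L'"
          using xs by (auto simp: incr_def)
        moreover have "map f xs ! m = f (xs ! m)" "map f xs ! (m + 1) = f (xs ! (m + 1))"
          using xs by (simp_all add: incr_def q_def)
        ultimately have prc: "pr (map f xs) \<in> cube n"
          unfolding pr_def using f_cube by simp
        then obtain y where y: "y \<in> cube n" "pr (map f xs) + y \<in> D (map f xs) \<longleftrightarrow> y \<notin> D (map f xs)"
          using bad[OF xs] unfolding good_def stab_def by blast
        have "\<exists>y. y \<in> cube n \<and> y \<in> D (map f xs) \<and> y + pr (map f xs) \<notin> D (map f xs)"
        proof (cases "y \<in> D (map f xs)")
          case True
          with y show ?thesis by (metis add.commute)
        next
          case False
          \<comment> \<open>Here the shift moves \<open>y\<close> into the set; since it is an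
            involution, it moves the shifted point out again.\<close>
          have "pr (map f xs) + y + pr (map f xs) = y"
            by (metis add.commute add_self_left)
          with False y prc show ?thesis by (metis cube_add)
        qed
        then show ?thesis
          unfolding Y_def by (rule someI_ex)
      qed
      interpret stable_connected n k d B by (rule sc)
      have nth: "map f xs ! i = f (xs ! i)" if "incr L' q xs" "i < q" for xs i
        using that by (simp add: incr_def)
      have W_eq: "W e (map f xs) = Y (map f xs) + (if e then (u \<circ> f) (xs ! (2 * 2 ^ d)) + (u \<circ> f) (xs ! (2 * 2 ^ d + 1)) else 0)"
        if "incr L' q xs" for e xs
        using nth[OF that, of m] nth[OF that, of "m + 1"] by (simp add: W_def pr_def q_def m_def)
      have D_eq: "D (map f xs) = maj B ((u \<circ> f) ` set (take (2 * 2 ^ d) xs))" for xs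
        by (simp add: D_def m_def take_map image_comp)
      show False
      proof (rule no_indiscernible_witness[of L' "u \<circ> f" "\<lambda>xs. Y (map f xs)"
            "\<lambda>e i. u (map f (xs0 0) ! i) + W e (map f (xs0 0)) \<in> B" K
            "\<lambda>e r. W e (take q (map f (xs0 r))) + (\<Sum>i\<leftarrow>drop q (map f (xs0 r)). u i) \<in> B"],
          unfold m_def[symmetric], fold q_def)
        show "(u \<circ> f) i \<in> cube n" if "i < L'" for i
          using f_cube[OF that] by simp
        show "indep_seq L' (u \<circ> f)"
          using indep_seq_comp[OF indep strict_mono_on_imp_inj_on[OF f(1)] f(2)] .
      next
        fix xs assume xs: "incr L' q xs"
        show "Y (map f xs) \<in> cube n"
          using Y[OF xs] by blast
        show "Y (map f xs) + (if False then (u \<circ> f) (xs ! m) + (u \<circ> f) (xs ! (m + 1)) else 0)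
          \<in> maj B ((u \<circ> f) ` set (take m xs))"
          using Y[OF xs] D_eq[of xs] by (simp add: m_def)
        show "Y (map f xs) + (if True then (u \<circ> f) (xs ! m) + (u \<circ> f) (xs ! (m + 1)) else 0)
          \<notin> maj B ((u \<circ> f) ` set (take m xs))"
          using Y[OF xs] D_eq[of xs] W_eq[OF xs, of True] by (simp add: m_def W_def)
      next
        fix e xs i assume xs: "incr L' q xs" and i: "i < m"
        show "(u \<circ> f) (xs ! i) + (Y (map f xs) + (if e then (u \<circ> f) (xs ! m) + (u \<circ> f) (xs ! (m + 1)) else 0)) \<in> B
          \<longleftrightarrow> u (map f (xs0 0) ! i) + W e (map f (xs0 0)) \<in> B"
          using hom0[OF xs _ i, of "xs0 0" e] xs0[of 0] W_eq[OF xs, of e] nth[OF xs, of i] i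
          by (cases e) (simp_all add: m_def q_def)
      next
        fix e xs r assume xs: "incr L' (q + r) xs" and r: "r \<le> K"
        have tk: "incr L' q (take q xs)"
          using xs set_take_subset[of q xs] by (auto simp: incr_def sorted_wrt_take)
        have "distinct (drop q (map f xs))"
          using incr_map[OF f xs] by (auto simp: incr_def strict_sorted_iff)
        then have "(\<Sum>i\<leftarrow>drop q (map f xs). u i) = (\<Sum>i\<in>set (drop q (map f xs)). u i)"
          by (rule sum_list_distinct_conv_sum_set)
        also have "\<dots> = (\<Sum>i\<in>f ` set (drop q xs). u i)"
          by (simp add: drop_map)
        also have "\<dots> = (\<Sum>i\<in>set (drop q xs). (u \<circ> f) i)"
        proof (rule sum.reindex)
          have "set (drop q xs) \<subseteq> {..<L'}"
            using xs set_drop_subset[of q xs] unfolding incr_def by blast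
          with strict_mono_on_imp_inj_on[OF f(1)] show "inj_on f (set (drop q xs))"
            by (rule inj_on_subset)
        qed
        finally have sum_eq: "(\<Sum>i\<leftarrow>drop q (map f xs). u i) = (\<Sum>i\<in>set (drop q xs). (u \<circ> f) i)" .
        show "Y (map f (take q xs)) + (if e then (u \<circ> f) (take q xs ! m) + (u \<circ> f) (take q xs ! (m + 1)) else 0)
            + (\<Sum>i\<in>set (drop q xs). (u \<circ> f) i) \<in> B
          \<longleftrightarrow> W e (take q (map f (xs0 r))) + (\<Sum>i\<leftarrow>drop q (map f (xs0 r)). u i) \<in> B"
          using hom1[OF xs xs0[OF r] r, of e] W_eq[OF tk, of e]
          unfolding sum_eq take_map by (cases e) (simp_all add: m_def)
      qed (auto simp: K_def L'_def m_def)
    qed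
    show "\<exists>f. strict_mono_on {..<L} f \<and> f ` {..<L} \<subseteq> {..<N} \<and>
      (\<forall>X j j'. card X = 2 * 2 ^ d \<longrightarrow> (\<forall>i\<in>X. i < j) \<longrightarrow> j < j' \<longrightarrow> j' < L \<longrightarrow>
        u (f j) + u (f j') \<in> stab n (maj B (u ` f ` X)))"
    proof (intro exI[of _ f] conjI allI impI)
      have "L \<le> L'" by (simp add: L'_def)
      then show "strict_mono_on {..<L} f" "f ` {..<L} \<subseteq> {..<N}"
        using f by (auto simp: strict_mono_on_def image_subset_iff)
      fix X j j' assume X: "card X = 2 * 2 ^ d" "\<forall>i\<in>X. i < j" and j: "j < j'" "j' < L"
      have finX: "finite X" using X(1) by (intro card_ge_0_finite) simp
      define xs where "xs = sorted_list_of_set X @ [j, j']"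
      have len: "length (sorted_list_of_set X) = m"
        using X(1) by (simp add: m_def)
      have "incr L' q xs"
        using X j finX \<open>L \<le> L'\<close> len by (auto simp: incr_def xs_def sorted_wrt_append q_def)
      then have "good (map f xs)"
        by (rule all_good)
      moreover have "map f xs ! m = f j" "map f xs ! (m + 1) = f j'" "set (take m (map f xs)) = f ` X"
        using finX len by (auto simp: xs_def nth_append take_map)
      ultimately show "u (f j) + u (f j') \<in> stab n (maj B (u ` f ` X))"
        by (simp add: good_def pr_def D_def)
    qed
  qed
qed

section \<open>Separation by cosets\<close>

text \<open>Records what the later choice of points provides: \<open>a j'\<close> and
  \<open>b j'\<close> lie in the same cosets through \<open>a j\<close> and \<open>b j\<close> of
  the stabilizers attached to still earlier points.\<close>

definition unseparated :: "nat \<Rightarrow> (nat \<Rightarrow> bit) set \<Rightarrow> nat \<Rightarrow> (nat \<Rightarrow> nat \<Rightarrow> bit) \<Rightarrow> (nat \<Rightarrow> nat \<Rightarrow> bit) \<Rightarrow> bool" where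
  "unseparated n B N a b \<longleftrightarrow> (\<forall>X j j'. (\<forall>i\<in>X. i < j) \<longrightarrow> j < j' \<longrightarrow> j' < N \<longrightarrow>
     (a j + a j' \<in> stab n (maj B (a ` X)) \<longleftrightarrow> a j + b j' \<in> stab n (maj B (a ` X))) \<and>
     (b j + b j' \<in> stab n (maj B (b ` X)) \<longleftrightarrow> b j + a j' \<in> stab n (maj B (b ` X))))"

lemma unseparated_comp:
  assumes "unseparated n B N a b" and f: "strict_mono_on {..<L} f" "f ` {..<L} \<subseteq> {..<N}"
  shows "unseparated n B L (a \<circ> f) (b \<circ> f)"
  unfolding unseparated_def
proof (intro allI impI)
  fix X j j' assume X: "\<forall>i\<in>X. i < j" and j: "j < j'" "j' < L"
  have "\<forall>i\<in>f ` X. i < f j" "f j < f j'" "f j' < N"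
    using X j f by (auto simp: strict_mono_on_def image_subset_iff)
  then show "((a \<circ> f) j + (a \<circ> f) j' \<in> stab n (maj B ((a \<circ> f) ` X)) \<longleftrightarrow>
        (a \<circ> f) j + (b \<circ> f) j' \<in> stab n (maj B ((a \<circ> f) ` X))) \<and>
     ((b \<circ> f) j + (b \<circ> f) j' \<in> stab n (maj B ((b \<circ> f) ` X)) \<longleftrightarrow>
        (b \<circ> f) j + (a \<circ> f) j' \<in> stab n (maj B ((b \<circ> f) ` X)))"
    using assms(1) unfolding unseparated_def comp_def image_image[symmetric, of _ f] by blast
qed

text \<open>Successive thinnings put the pair sums of \<open>a\<close>, then those of
  \<open>b\<close>, into stabilizers, and finally make mixed triples homogeneous. The stabilizer
  statements concern all earlier \<open>X\<close>, so they survive the later thinnings.\<close>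

lemma no_long_unseparated:
  fixes k d :: nat
  shows "\<exists>N. \<forall>n B a b. stable_connected n k d B \<longrightarrow> (\<forall>i<N. a i \<in> B \<and> b i \<in> cube n - B) \<longrightarrow>
    indep_seq N a \<longrightarrow> indep_seq N b \<longrightarrow> \<not> unseparated n B N a b"
proof -
  define m :: nat where "m = 2 * 2 ^ d"
  define L where "L = m + 4"
  \<comment> \<open>The three order patterns abb, bab and bba of a mixed triple.\<close>
  define seqs :: "nat \<Rightarrow> (nat \<Rightarrow> nat \<Rightarrow> bit) \<Rightarrow> (nat \<Rightarrow> nat \<Rightarrow> bit) \<Rightarrow> nat \<Rightarrow> nat \<Rightarrow> nat \<Rightarrow> nat \<Rightarrow> bit" where
    "seqs = (\<lambda>t a b i j l. if t = 0 then a i + (b j + b l) else if t = 1 then b i + (a j + b l) else b i + (b j + a l))"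
  obtain N3 where N3: "\<And>P :: nat \<Rightarrow> nat list \<Rightarrow> bool. \<exists>f. strict_mono_on {..<L} f \<and> f ` {..<L} \<subseteq> {..<N3} \<and>
    (\<forall>t\<in>{..<3}. \<forall>xs ys. incr L 3 xs \<longrightarrow> incr L 3 ys \<longrightarrow> P t (map f xs) = P t (map f ys))"
    using indiscernible_subsequence[of "{..<3}" L "\<lambda>_. 3"] by blast
  obtain N2 where N2: "\<And>n B (u :: nat \<Rightarrow> nat \<Rightarrow> bit). stable_connected n k d B \<Longrightarrow> (\<forall>i<N2. u i \<in> cube n) \<Longrightarrow>
    indep_seq N2 u \<Longrightarrow> \<exists>f. strict_mono_on {..<N3} f \<and> f ` {..<N3} \<subseteq> {..<N2} \<and>
      (\<forall>X j j'. card X = m \<longrightarrow> (\<forall>i\<in>X. i < j) \<longrightarrow> j < j' \<longrightarrow> j' < N3 \<longrightarrow>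
        u (f j) + u (f j') \<in> stab n (maj B (u ` f ` X)))"
    using pair_sums_in_stab[where k = k and d = d and L = N3] unfolding m_def by metis
  obtain N where N: "\<And>n B (u :: nat \<Rightarrow> nat \<Rightarrow> bit). stable_connected n k d B \<Longrightarrow> (\<forall>i<N. u i \<in> cube n) \<Longrightarrow>
    indep_seq N u \<Longrightarrow> \<exists>f. strict_mono_on {..<N2} f \<and> f ` {..<N2} \<subseteq> {..<N} \<and>
      (\<forall>X j j'. card X = m \<longrightarrow> (\<forall>i\<in>X. i < j) \<longrightarrow> j < j' \<longrightarrow> j' < N2 \<longrightarrow>
        u (f j) + u (f j') \<in> stab n (maj B (u ` f ` X)))"
    using pair_sums_in_stab[where k = k and d = d and L = N2] unfolding m_def by metis
  show ?thesis
  proof (intro exI[of _ N] allI impI notI)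
    fix n B and a0 b0 :: "nat \<Rightarrow> nat \<Rightarrow> bit"
    assume sc: "stable_connected n k d B" and mem: "\<forall>i<N. a0 i \<in> B \<and> b0 i \<in> cube n - B"
      and indep: "indep_seq N a0" "indep_seq N b0" and unsep: "unseparated n B N a0 b0"
    interpret stable_connected n k d B by (rule sc)
    obtain f1 where f1: "strict_mono_on {..<N2} f1" "f1 ` {..<N2} \<subseteq> {..<N}"
      and stab1: "\<And>X j j'. card X = m \<Longrightarrow> \<forall>i\<in>X. i < j \<Longrightarrow> j < j' \<Longrightarrow> j' < N2 \<Longrightarrow>
        a0 (f1 j) + a0 (f1 j') \<in> stab n (maj B (a0 ` f1 ` X))"
      using N[OF sc _ indep(1)] mem B_sub by blast
    have indep1: "indep_seq N2 (b0 \<circ> f1)"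
      using indep_seq_comp[OF indep(2) strict_mono_on_imp_inj_on[OF f1(1)] f1(2)] .
    have "\<forall>i<N2. (b0 \<circ> f1) i \<in> cube n"
      using mem f1(2) by auto
    then obtain f2 where f2: "strict_mono_on {..<N3} f2" "f2 ` {..<N3} \<subseteq> {..<N2}"
      and stab2: "\<And>X j j'. card X = m \<Longrightarrow> \<forall>i\<in>X. i < j \<Longrightarrow> j < j' \<Longrightarrow> j' < N3 \<Longrightarrow>
        (b0 \<circ> f1) (f2 j) + (b0 \<circ> f1) (f2 j') \<in> stab n (maj B ((b0 \<circ> f1) ` f2 ` X))"
      using N2[OF sc _ indep1] by blast
    define f12 where "f12 = f1 \<circ> f2"
    obtain f3 where f3: "strict_mono_on {..<L} f3" "f3 ` {..<L} \<subseteq> {..<N3}"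
      and hom: "\<forall>t\<in>{..<3}. \<forall>xs ys. incr L 3 xs \<longrightarrow> incr L 3 ys \<longrightarrow>
        (seqs t (a0 \<circ> f12) (b0 \<circ> f12) (map f3 xs ! 0) (map f3 xs ! 1) (map f3 xs ! 2) \<in> B) =
        (seqs t (a0 \<circ> f12) (b0 \<circ> f12) (map f3 ys ! 0) (map f3 ys ! 1) (map f3 ys ! 2) \<in> B)"
      using N3[of "\<lambda>t zs. seqs t (a0 \<circ> f12) (b0 \<circ> f12) (zs ! 0) (zs ! 1) (zs ! 2) \<in> B"]
      by (elim exE conjE) (rule that)
    define f where "f = f12 \<circ> f3"
    have f12: "strict_mono_on {..<N3} f12" "f12 ` {..<N3} \<subseteq> {..<N}"
      using strict_mono_on_comp[OF f2 f1(1)] f1(2) f2(2) by (auto simp: f12_def)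
    have f: "strict_mono_on {..<L} f" "f ` {..<L} \<subseteq> {..<N}"
      using strict_mono_on_comp[OF f3 f12(1)] f12(2) f3(2) by (auto simp: f_def)
    define a where "a = a0 \<circ> f"
    define b where "b = b0 \<circ> f"
    have a: "a i \<in> B" "a i \<in> cube n" and b: "b i \<in> cube n" "b i \<notin> B" if "i < L" for i
      using mem f(2) that B_sub by (auto simp: a_def b_def)
    have hom: "seqs t a b i j l \<in> B \<longleftrightarrow> seqs t a b i' j' l' \<in> B"
      if "t < 3" "i < j" "j < l" "l < L" "i' < j'" "j' < l'" "l' < L" for t i j l i' j' l'
    proof -
      have "incr L 3 [i, j, l]" "incr L 3 [i', j', l']"
        using that by (auto simp: incr_def)
      moreover have "seqs t a b i j l = seqs t (a0 \<circ> f12) (b0 \<circ> f12) (f3 i) (f3 j) (f3 l)" for i j l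
        by (simp add: seqs_def a_def b_def f_def)
      ultimately show ?thesis
        using hom[rule_format, of t "[i, j, l]" "[i', j', l']"] that(1) by simp
    qed
    have unsep: "unseparated n B L a b"
      unfolding a_def b_def using unseparated_comp[OF unsep f] .
    have X: "card {..<m} = m" "\<forall>i\<in>{..<m}. i < m" by auto
    have stab_a: "a j + a j' \<in> stab n (maj B (a ` {..<m}))" if "m \<le> j" "j < j'" "j' < L" for j j'
    proof -
      have "card (f2 ` f3 ` {..<m}) = m"
      proof -
        have "inj_on (f2 \<circ> f3) {..<m}"
          using strict_mono_on_imp_inj_on[OF strict_mono_on_comp[OF f3 f2(1)]]
          by (elim inj_on_subset) (auto simp: L_def)
        then have "card ((f2 \<circ> f3) ` {..<m}) = m" by (simp add: card_image del: o_apply)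
        then show ?thesis unfolding image_comp .
      qed
      moreover have "\<forall>i\<in>f2 ` f3 ` {..<m}. i < f2 (f3 j)" "f2 (f3 j) < f2 (f3 j')" "f2 (f3 j') < N2"
        using strict_mono_on_comp[OF f3 f2(1)] f2(2) f3(2) that by (auto simp: strict_mono_on_def image_subset_iff)
      ultimately show ?thesis
        using stab1[of "f2 ` f3 ` {..<m}" "f2 (f3 j)" "f2 (f3 j')"]
        by (simp add: a_def f_def f12_def image_comp comp_def)
    qed
    have stab_b: "b j + b j' \<in> stab n (maj B (b ` {..<m}))" if "m \<le> j" "j < j'" "j' < L" for j j'
    proof -
      have "card (f3 ` {..<m}) = m"
      proof -
        have "inj_on f3 {..<m}"
          using strict_mono_on_imp_inj_on[OF f3(1)] by (elim inj_on_subset) (auto simp: L_def)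
        then show ?thesis by (simp add: card_image)
      qed
      moreover have "\<forall>i\<in>f3 ` {..<m}. i < f3 j" "f3 j < f3 j'" "f3 j' < N3"
        using f3 that by (auto simp: strict_mono_on_def image_subset_iff)
      ultimately show ?thesis
        using stab2[of "f3 ` {..<m}" "f3 j" "f3 j'"]
        by (simp add: b_def f_def f12_def image_comp comp_def)
    qed
    have m: "m > 0" by (simp add: m_def)
    \<comment> \<open>Both \<open>b\<close> terms can be paired with \<open>a m\<close> inside the
      stabilizer, so their sum is in it. As 0 belongs to the majority set of terms from
      \<open>B\<close>, so does that sum, and some earlier \<open>a i'\<close> gives pattern abb in
      \<open>B\<close>.\<close>
    have "b (m + 1) + b (m + 2) \<in> stab n (maj B (a ` {..<m}))"
    proof -
      have ab: "a m + b j' \<in> stab n (maj B (a ` {..<m}))" if "m < j'" "j' < L" for j'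
        using unsep stab_a[of m j'] X(2) that unfolding unseparated_def by blast
      have "(a m + b (m + 1)) + (a m + b (m + 2)) \<in> stab n (maj B (a ` {..<m}))"
        by (intro stab_add ab) (auto simp: L_def)
      moreover have "(a m + b (m + 1)) + (a m + b (m + 2)) = b (m + 1) + b (m + 2)"
        by (simp only: add_ac add_self_left)
      ultimately show ?thesis by simp
    qed
    moreover have card_a: "card (a ` {..<m}) > 0" and card_b: "card (b ` {..<m}) > 0"
      using m by (auto simp: card_gt_0_iff)
    have "0 \<in> maj B (a ` {..<m})"
      using not_maj_imp_ex[OF _ card_a, of 0 B] a(1) by (auto simp: L_def)
    ultimately have "b (m + 1) + b (m + 2) \<in> maj B (a ` {..<m})"
      by (simp only: stab_mem_iff)
    from maj_imp_ex[OF this] obtain i' where i: "i' < m" "seqs 0 a b i' (m + 1) (m + 2) \<in> B"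
      by (auto simp: seqs_def)
    have abb: "a i + (b j + b l) \<in> B" if "i < j" "j < l" "l < L" for i j l
      using hom[of 0 i j l i' "m + 1" "m + 2"] that i by (simp add: seqs_def L_def)
    \<comment> \<open>The same for the terms outside \<open>B\<close>: 0 is not in their majority
      set, so pattern bba occurs outside \<open>B\<close>.\<close>
    have "b m + a (m + 1) \<in> stab n (maj B (b ` {..<m}))"
      using unsep stab_b[of m "m + 1"] X(2) unfolding unseparated_def by (simp add: L_def)
    moreover have "0 \<notin> maj B (b ` {..<m})"
      using maj_imp_ex[of 0 B "b ` {..<m}"] b(2) by (auto simp: L_def)
    ultimately have "b m + a (m + 1) \<notin> maj B (b ` {..<m})"
      by (simp only: stab_mem_iff not_False_eq_True)
    from not_maj_imp_ex[OF this card_b] obtain i' where i': "i' < m" "seqs 2 a b i' m (m + 1) \<notin> B"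
      by (auto simp: seqs_def)
    have bba: "b i + (b j + a l) \<notin> B" if "i < j" "j < l" "l < L" for i j l
      using hom[of 2 i j l i' m "m + 1"] that i' by (simp add: seqs_def L_def)
    have bab: "b i + (a j + b l) \<in> B \<longleftrightarrow> b 0 + (a 1 + b 2) \<in> B" if "i < j" "j < l" "l < L" for i j l
      using hom[of 1 i j l 0 1 2] that m by (simp add: seqs_def L_def)
    show False
    \<comment> \<open>Interleaving \<open>a\<close> at indices of one parity with \<open>b\<close>
      at the other, the order of \<open>i\<close> and \<open>t\<close> selects between two patterns:
      bab against bba if bab lies in \<open>B\<close>, and abb against bab otherwise. In both cases
      this is a half graph.\<close>
    proof (cases "b 0 + (a 1 + b 2) \<in> B")
      case True
      show False
      proof (rule no_halfgraph[of "\<lambda>i. b 0 + a (2 * i + 2)" "\<lambda>t. b (2 * t + 1)" True])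
        show "b 0 + a (2 * i + 2) \<in> cube n" "b (2 * i + 1) \<in> cube n" if "i < 2 ^ d" for i
          using that a(2) b(1) by (simp_all add: L_def m_def)
        fix i t :: nat assume i: "i < 2 ^ d" and t: "t < 2 ^ d"
        show "b 0 + a (2 * i + 2) + b (2 * t + 1) \<in> B \<longleftrightarrow> (i < t) = True"
        proof (cases "i < t")
          case le: True
          then show ?thesis
            using bab[of 0 "2 * i + 2" "2 * t + 1"] t True by (simp add: L_def m_def add.assoc)
        next
          case False
          then show ?thesis
            using bba[of 0 "2 * t + 1" "2 * i + 2"] i by (simp add: L_def m_def add_ac)
        qed
      qed
    next
      case False
      show False
      proof (rule no_halfgraph[of "\<lambda>i. a (2 * i + 1)" "\<lambda>t. b (2 * t) + b (L - 1)" True])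
        show "a (2 * i + 1) \<in> cube n" "b (2 * i) + b (L - 1) \<in> cube n" if "i < 2 ^ d" for i
          using that a(2) b(1) by (simp_all add: L_def m_def)
        fix i t :: nat assume i: "i < 2 ^ d" and t: "t < 2 ^ d"
        show "a (2 * i + 1) + (b (2 * t) + b (L - 1)) \<in> B \<longleftrightarrow> (i < t) = True"
        proof (cases "i < t")
          case True
          then show ?thesis
            using abb[of "2 * i + 1" "2 * t" "L - 1"] t by (simp add: L_def m_def)
        next
          case ge: False
          then show ?thesis
            using bab[of "2 * t" "2 * i + 1" "L - 1"] i False by (simp add: L_def m_def add.left_commute)
        qed
      qed
    qed
  qed
qed

section \<open>Choosing unseparated points\<close>

text \<open>Repeated vectors cancel in pairs, so a sum over indices becomes a sum over a set of
  vectors, the form in which the coset family is built.\<close>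

lemma sum_subset_image:
  fixes u :: "nat \<Rightarrow> nat \<Rightarrow> bit"
  assumes "finite S"
  shows "\<exists>X\<subseteq>u ` S. (\<Sum>i\<in>S. u i) = \<Sum>X"
  using assms
proof (induction S)
  case (insert i S)
  then obtain X where X: "X \<subseteq> u ` S" "(\<Sum>i\<in>S. u i) = \<Sum>X" by blast
  then have fin: "finite X" using insert.hyps finite_subset by blast
  show ?case
  proof (cases "u i \<in> X")
    case True
    then have "(\<Sum>j\<in>insert i S. u j) = \<Sum>(X - {u i})"
      using insert.hyps X(2) fin by (simp add: sum.remove)
    then show ?thesis using X(1) by (intro exI[of _ "X - {u i}"]) auto
  next
    case False
    then have "(\<Sum>j\<in>insert i S. u j) = \<Sum>(insert (u i) X)"
      using insert.hyps X(2) fin by simp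
    then show ?thesis using X(1) by (intro exI[of _ "insert (u i) X"]) auto
  qed
qed auto

text \<open>If the complexity exceeds \<open>l\<close>, no family attached to at most
  \<open>2 * N\<close> points generates \<open>A\<close>, so each fails to separate some point of
  \<open>A\<close> from a point outside. Iterating \<open>N\<close> times contradicts
  \<open>no_long_unseparated\<close>.\<close>

lemma coset_complexity_bounded:
  fixes k d :: nat
  shows "\<exists>l. \<forall>n A. stable_connected n k d A \<longrightarrow> coset_complexity_le n A l"
proof -
  obtain N where N: "\<And>n B a b. stable_connected n k d B \<Longrightarrow> \<forall>i<N. a i \<in> B \<and> b i \<in> cube n - B \<Longrightarrow>
    indep_seq N a \<Longrightarrow> indep_seq N b \<Longrightarrow> \<not> unseparated n B N a b"
    using no_long_unseparated[of k d] by blast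
  \<comment> \<open>Counts the cosets attached to a set of at most \<open>2 * N\<close> points: one
    for each subset sum, and one for each pair of a point and a subset.\<close>
  define l where "l = 2 ^ (2 * N) + 2 * N * 2 ^ (2 * N)"
  have "coset_complexity_le n A l" if sc: "stable_connected n k d A" for n A
  proof (rule ccontr)
    assume contra: "\<not> coset_complexity_le n A l"
    have A: "A \<subseteq> cube n" using sc by (rule stable_connected.B_sub)
    \<comment> \<open>The singletons will force the chosen sequences to be independent; the
      stabilizer cosets will make them \<open>unseparated\<close>.\<close>
    define F where "F M = (\<lambda>X. {\<Sum>X}) ` Pow M \<union>
      (\<lambda>(c, X). (\<lambda>h. c + h) ` stab n (maj A X)) ` (M \<times> Pow M)" for M
    have ex: "\<exists>x y. x \<in> A \<and> y \<in> cube n - A \<and> (\<forall>C\<in>F M. x \<in> C \<longleftrightarrow> y \<in> C)"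
      if M: "M \<subseteq> cube n" "card M \<le> 2 * N" for M
    proof -
      have fin: "finite M" using M(1) finite_cube by (rule finite_subset)
      then have finF: "finite (F M)" by (simp add: F_def)
      have pow: "2 ^ card M \<le> (2 :: nat) ^ (2 * N)"
        using M(2) by (intro power_increasing) auto
      have "card (F M) \<le> card (Pow M) + card (M \<times> Pow M)"
        unfolding F_def using fin by (intro order_trans[OF card_Un_le] add_mono card_image_le) auto
      also have "\<dots> \<le> l"
        using fin pow M(2) unfolding l_def by (simp add: card_Pow card_cartesian_product add_mono mult_mono)
      finally have "card (F M) \<le> l" .
      moreover have cosets: "is_coset n C" if "C \<in> F M" for C
      proof -
        consider X where "X \<subseteq> M" "C = {\<Sum>X}"
          | c X where "c \<in> M" "C = (\<lambda>h. c + h) ` stab n (maj A X)"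
          using \<open>C \<in> F M\<close> by (auto simp: F_def)
        then show ?thesis
        proof cases
          case 1
          have "\<Sum>X \<in> cube n" using 1(1) M(1) by (intro cube_sum) auto
          then show ?thesis
            unfolding is_coset_def 1(2)
            by (intro exI[of _ "{0}"] exI[of _ "\<Sum>X"]) (simp add: F2.subspace_0 F2.subspace_single_0)
        next
          case 2
          then show ?thesis
            unfolding is_coset_def using M(1) subspace_stab
            by (intro exI[of _ "stab n (maj A X)"] exI[of _ c]) (auto simp: stab_def)
        qed
      qed
      ultimately have not_hull: "A \<notin> algebra (cube n) hull (F M)"
        using contra finF unfolding coset_complexity_le_def by blast
      have F_sub: "F M \<subseteq> Pow (cube n)"
        using cosets coset_subset_cube by blast
      show ?thesis
      proof (rule ccontr)
        assume no_pair: "\<not> ?thesis"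
        have "A \<in> algebra (cube n) hull (F M)"
        proof (rule mem_hull_algebra[OF finF F_sub A])
          fix x y assume "x \<in> A" "y \<in> cube n - A"
          with no_pair have "\<not> (\<forall>C\<in>F M. x \<in> C \<longleftrightarrow> y \<in> C)" by metis
          then show "\<exists>C\<in>F M. x \<in> C \<longleftrightarrow> y \<notin> C" by metis
        qed
        with not_hull show False ..
      qed
    qed
    define px where "px M = (SOME x. \<exists>y. x \<in> A \<and> y \<in> cube n - A \<and> (\<forall>C\<in>F M. x \<in> C \<longleftrightarrow> y \<in> C))" for M
    define py where "py M = (SOME y. px M \<in> A \<and> y \<in> cube n - A \<and> (\<forall>C\<in>F M. px M \<in> C \<longleftrightarrow> y \<in> C))" for M
    have pxy: "px M \<in> A \<and> py M \<in> cube n - A \<and> (\<forall>C\<in>F M. px M \<in> C \<longleftrightarrow> py M \<in> C)"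
      if "M \<subseteq> cube n" "card M \<le> 2 * N" for M
    proof -
      have "\<exists>y. px M \<in> A \<and> y \<in> cube n - A \<and> (\<forall>C\<in>F M. px M \<in> C \<longleftrightarrow> y \<in> C)"
        unfolding px_def using ex[OF that] by (rule someI_ex)
      then show ?thesis unfolding py_def by (rule someI_ex)
    qed
    define Ms where "Ms = rec_nat {} (\<lambda>_ M. insert (px M) (insert (py M) M))"
    have Ms_simps: "Ms 0 = {}" "Ms (Suc j) = insert (px (Ms j)) (insert (py (Ms j)) (Ms j))" for j
      by (simp_all add: Ms_def)
    have Ms: "Ms j \<subseteq> cube n \<and> card (Ms j) \<le> 2 * j" if "j \<le> N" for j
      using that
    proof (induction j)
      case (Suc j)
      then have IH: "Ms j \<subseteq> cube n" "card (Ms j) \<le> 2 * j" by auto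
      have "px (Ms j) \<in> cube n" "py (Ms j) \<in> cube n"
        using pxy[of "Ms j"] IH Suc.prems A by auto
      moreover have "card (Ms (Suc j)) \<le> card (Ms j) + 2"
      proof -
        have fin: "finite (Ms j)" using IH(1) finite_cube by (rule finite_subset)
        have "card (insert (px (Ms j)) (insert (py (Ms j)) (Ms j))) \<le> Suc (card (insert (py (Ms j)) (Ms j)))"
          using fin by (simp add: card_insert_if)
        also have "\<dots> \<le> card (Ms j) + 2"
          using fin by (simp add: card_insert_if)
        finally show ?thesis by (simp add: Ms_simps)
      qed
      ultimately show ?case
        using IH by (simp add: Ms_simps)
    qed (simp add: Ms_simps)
    define a where "a j = px (Ms j)" for j
    define b where "b j = py (Ms j)" for j
    have ab: "a j \<in> A" "b j \<in> cube n - A" "\<And>C. C \<in> F (Ms j) \<Longrightarrow> a j \<in> C \<longleftrightarrow> b j \<in> C" if "j < N" for j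
      using pxy[of "Ms j"] Ms[of j] that by (auto simp: a_def b_def)
    have in_Ms: "a i \<in> Ms j" "b i \<in> Ms j" if "i < j" for i j
      using that by (induction j) (auto simp: Ms_simps a_def b_def less_Suc_eq)
    have indep: "indep_seq N u" if u: "\<And>i j. i < j \<Longrightarrow> u i \<in> Ms j" "u = a \<or> u = b" for u
      unfolding indep_seq_def
    proof (intro allI impI notI)
      fix S assume S: "S \<subseteq> {..<N}" "S \<noteq> {}" "(\<Sum>i\<in>S. u i) = 0"
      have fin: "finite S" using S(1) finite_subset by auto
      define j where "j = Max S"
      have j: "j \<in> S" "\<And>i. i \<in> S \<Longrightarrow> i \<le> j"
        using fin S(2) by (auto simp: j_def)
      \<comment> \<open>In a vanishing sum the last term equals a subset sum of earlier points. The
        corresponding singleton would contain both \<open>a j\<close> and \<open>b j\<close>, which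
        are distinct.\<close>
      obtain X where X: "X \<subseteq> u ` (S - {j})" "(\<Sum>i\<in>S - {j}. u i) = \<Sum>X"
        using sum_subset_image[of "S - {j}" u] fin by auto
      have "X \<subseteq> Ms j"
      proof
        fix x assume "x \<in> X"
        then obtain i where "i \<in> S" "i \<noteq> j" "x = u i" using X(1) by blast
        then show "x \<in> Ms j" using u(1)[of i j] j(2)[of i] by simp
      qed
      then have "{\<Sum>X} \<in> F (Ms j)" by (auto simp: F_def)
      moreover have "u j = \<Sum>X"
        using S(3) X(2) j(1) fin by (simp add: sum.remove[of S j] add_eq_iff)
      moreover have "j < N" using j(1) S(1) by auto
      ultimately have "a j = b j"
        using ab(3)[of j "{\<Sum>X}"] u(2) by auto
      then show False
        using ab(1,2)[OF \<open>j < N\<close>] by simp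
    qed
    have "unseparated n A N a b"
      unfolding unseparated_def
    proof (intro allI impI)
      fix X j j' assume X: "\<forall>i\<in>X. i < j" and j: "j < j'" "j' < N"
      have coset: "(\<lambda>h. u j + h) ` stab n (maj A (u ` X)) \<in> F (Ms j')"
        if "\<And>i. i < j' \<Longrightarrow> u i \<in> Ms j'" for u
      proof -
        have "u j \<in> Ms j'" "u ` X \<subseteq> Ms j'"
          using that X j by auto
        then have "(u j, u ` X) \<in> Ms j' \<times> Pow (Ms j')" by simp
        then show ?thesis unfolding F_def by (intro UnI2 rev_image_eqI) auto
      qed
      have mem: "x \<in> (\<lambda>h. c + h) ` H \<longleftrightarrow> c + x \<in> H" for x c :: "nat \<Rightarrow> bit" and H
        by (metis (no_types, lifting) add_self_left image_iff)
      show "(a j + a j' \<in> stab n (maj A (a ` X)) \<longleftrightarrow> a j + b j' \<in> stab n (maj A (a ` X))) \<and>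
        (b j + b j' \<in> stab n (maj A (b ` X)) \<longleftrightarrow> b j + a j' \<in> stab n (maj A (b ` X)))"
        using ab(3)[OF j(2) coset[of a]] ab(3)[OF j(2) coset[of b]] in_Ms unfolding mem by blast
    qed
    moreover have "indep_seq N a" "indep_seq N b"
      using in_Ms by (auto intro: indep)
    ultimately show False
      using N[OF sc, of a b] ab(1,2) by blast
  qed
  then show ?thesis by blast
qed

theorem theorem1p5:
  fixes k M :: nat and \<epsilon> :: real
  assumes "0 \<le> \<epsilon>" and "\<epsilon> < 1 / 2"
  shows "\<exists>l::nat. \<forall>n. \<forall>A\<subseteq>cube n.
           approx_algebra_norm n \<epsilon> (indicat_real A) \<le> real M \<longrightarrow>
             ((\<not> affine_connected k A \<or> \<not> affine_connected k (cube n - A)) \<and>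
                \<not> (k = 1 \<and> A = {}) \<longrightarrow>
                algebra_norm n (indicat_real A) \<ge> sqrt (real k) / 2) \<and>
             (affine_connected k A \<and> affine_connected k (cube n - A) \<longrightarrow>
                coset_complexity_le n A l \<and> algebra_norm n (indicat_real A) \<le> 3 ^ l)"
proof -
  \<comment> \<open>The depth of excluded mistake trees depends only on \<open>M\<close> and
    \<open>\<epsilon>\<close>, so \<open>l\<close> is chosen before \<open>n\<close> and
    \<open>A\<close>.\<close>
  obtain d :: nat where d: "real d > ((real M + 2) / (1 / 2 - \<epsilon>)) ^ 2"
    using reals_Archimedean2 by blast
  obtain l where l: "\<And>n A. stable_connected n k d A \<Longrightarrow> coset_complexity_le n A l"
    using coset_complexity_bounded by blast
  show ?thesis
  proof (intro exI[of _ l] allI impI conjI)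
    fix n A
    assume A: "A \<subseteq> cube n" and norm: "approx_algebra_norm n \<epsilon> (indicat_real A) \<le> real M"
    show "sqrt (real k) / 2 \<le> algebra_norm n (indicat_real A)"
      if "(\<not> affine_connected k A \<or> \<not> affine_connected k (cube n - A)) \<and> \<not> (k = 1 \<and> A = {})"
      using that A by (intro algebra_norm_ge_not_connected) auto
    assume "affine_connected k A \<and> affine_connected k (cube n - A)"
    then have "stable_connected n k d A"
      using A approx_norm_not_shatter[OF assms A norm d] by unfold_locales auto
    then show "coset_complexity_le n A l"
      by (rule l)
    then show "algebra_norm n (indicat_real A) \<le> 3 ^ l"
      by (rule algebra_norm_coset_complexity)
  qed
qed

end
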